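(* Let $X=N_{\mathbb R}/M'$ be a tropical abelian variety of dimension $n\ge1$ with projection $\pi:N_{\mathbb R}\to X$. Let $L=L(\lambda,\gamma)$ be a positive tropical line bundle on $X$, given by a tropical descent datum $(\lambda,\gamma)$, of polarization type $(d_1,\dots,d_n)$. Set $D=d_1\cdots d_n$ and let $\{b_1,\dots,b_D\}$ be a complete system of representatives of $M/\lambda(M')$. For each $i$ let $\bar\vartheta_{b_i}^{(\lambda,\gamma)}\in H^0(X,L)$ be the regular global section with $\pi^*(\bar\vartheta_{b_i}^{(\lambda,\gamma)})=\vartheta_{b_i}^{(\lambda,\gamma)}$, where $$\vartheta_b^{(\lambda,\gamma)}(x)=\min_{u'\in M'}\big(\langle b+\lambda(u'),x\rangle+\gamma(u')+\langle b,u'\rangle\big).$$ Let $\varphi:X\to\mathbb{TP}^{D-1}$ be the map $x\mapsto(\bar\vartheta_{b_1}^{(\lambda,\gamma)}(x):\cdots:\bar\vartheta_{b_D}^{(\lambda,\gamma)}(x))$. Then: (1) if $d_1\ge3$, then $\varphi$ is a homeomorphism onto its image; (2) if $d_1\ge2(n-1)!$, then $\varphi$ is unimodular; (3) if $d_1\ge\max\{3,2(n-1)!\}$, then $\varphi$ is a faithful embedding.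
   Context: $\mathbb T=\mathbb R\cup\{+\infty\}$. $M$ is a free $\mathbb Z$-module of rank $n$, $N=\operatorname{Hom}(M,\mathbb Z)$, $N_{\mathbb R}=\operatorname{Hom}(M,\mathbb R)$, $\langle\cdot,\cdot\rangle:M\times N_{\mathbb R}\to\mathbb R$ the pairing, $M'\subset N_{\mathbb R}$ a full lattice. $X=N_{\mathbb R}/M'$ is a real torus (with integral structure $N$). A rational polyhedral decomposition of $N_{\mathbb R}$ is a locally finite polyhedral complex covering $N_{\mathbb R}$ with cells cut out by finitely many inequalities $\langle u,x\rangle\ge b$, $u\in M$, $b\in\mathbb R$. A function is piecewise $\mathbb Z$-affine if on each cell of some such decomposition it equals $\langle u,\cdot\rangle+b$, $u\in M$, $b\in\mathbb R$. A regular function on $N_{\mathbb R}$ is $+\infty$ or a concave piecewise $\mathbb Z$-affine real function. A tropical descent datum is $(\lambda,\gamma)$ with $\lambda:M'\to M$ a homomorphism, $\gamma:M'\to\mathbb R$, and $\gamma(u_1'+u_2')-\gamma(u_1')-\gamma(u_2')=\langle\lambda(u_2'),u_1'\rangle$. The tropical line bundle $L(\lambda,\gamma)$ on $X$ is the quotient of $N_{\mathbb R}\times\mathbb T$ by $u'\cdot(x,t)=(x+u',t-\langle\lambda(u'),x\rangle-\gamma(u'))$, and $H^0(X,L(\lambda,\gamma))$ is identified via $\pi^*$ with the tropical theta functions for $(\lambda,\gamma)$: regular functions $\vartheta$ on $N_{\mathbb R}$ with $\vartheta(x+u')=\vartheta(x)-\langle\lambda(u'),x\rangle-\gamma(u')$.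 $Q$ is the symmetric $\mathbb R$-bilinear form on $N_{\mathbb R}$ with $Q(u_1',u_2')=\langle\lambda(u_1'),u_2'\rangle$ for $u_i'\in M'$. $\lambda$ is a polarization, and $L(\lambda,\gamma)$ is positive, if $Q$ is positive-definite; $X$ is a tropical abelian variety if it has a polarization. The type $(d_1,\dots,d_n)$ of a polarization (and of $L$) consists of the positive integers with $d_i\mid d_{i+1}$ such that $\lambda$ is represented by $\mathrm{diag}(d_1,\dots,d_n)$ in suitable $\mathbb Z$-bases of $M'$ and $M$. If $\lambda$ is a polarization the minima above exist and $\vartheta_b^{(\lambda,\gamma)}$ is a tropical theta function for $(\lambda,\gamma)$. Here $(\bar\vartheta_{b_1}(x):\cdots)$ means $(\vartheta_{b_1}(\tilde x):\cdots:\vartheta_{b_D}(\tilde x))$ for any lift $\tilde x\in N_{\mathbb R}$, an element of $\mathbb R^D/\mathbb R(1,\dots,1)\subset\mathbb{TP}^{D-1}$, identified with $\mathbb R^{D-1}$ by subtracting the first coordinate. A map $\varphi:X\to\mathbb R^m$ is unimodular if there is a rational polyhedral decomposition of $N_{\mathbb R}$ on each cell of which $\varphi\circ\pi$ agrees with an affine map whose linear part is the extension of an injective homomorphism $N\to\mathbb Z^m$ with torsion-free cokernel; it is a faithful embedding if it is unimodular and a homeomorphism onto its image. *)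

theory Defs
  imports "HOL-Analysis.Analysis"
begin

text \<open>
  The real vector space \<open>N\<^sub>\<real> = Hom(M, \<real>)\<close> is an arbitrary Euclidean space \<open>'a\<close>, and \<open>n = DIM('a)\<close>.
  The free module \<open>M\<close> of rank \<open>n\<close> is a full lattice in the dual space of \<open>'a\<close>, which the inner
  product identifies with \<open>'a\<close>. So \<open>M\<close> is a full lattice in \<open>'a\<close>, the pairing \<open>\<langle>u, x\<rangle>\<close> is
  \<open>u \<bullet> x\<close>, and every homomorphism \<open>M \<rightarrow> \<real>\<close> is \<open>u \<mapsto> u \<bullet> x\<close> for exactly one \<open>x\<close>. The inner product has
  no further role; no relation between it and \<open>M\<close> or \<open>M'\<close> is assumed. Indices of bases, types and
  representatives run from 1.
\<close>

subsection \<open>Lattices and tori\<close>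

definition is_zbasis :: "'a::euclidean_space set \<Rightarrow> (nat \<Rightarrow> 'a) \<Rightarrow> bool" where
  "is_zbasis \<Lambda> e \<longleftrightarrow>
     inj_on e {1..DIM('a)} \<and> independent (e ` {1..DIM('a)}) \<and>
     \<Lambda> = {\<Sum>i=1..DIM('a). of_int (c i) *\<^sub>R e i | c :: nat \<Rightarrow> int. True}"

definition full_lattice :: "'a::euclidean_space set \<Rightarrow> bool" where
  "full_lattice \<Lambda> \<longleftrightarrow> (\<exists>e. is_zbasis \<Lambda> e)"

text \<open>\<open>N = Hom(M, \<int>)\<close> inside \<open>N\<^sub>\<real>\<close>:\<close>

definition dual_lattice :: "'a::euclidean_space set \<Rightarrow> 'a set" where
  "dual_lattice M = {x. \<forall>u\<in>M. u \<bullet> x \<in> \<int>}"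

definition torus_proj :: "'a::euclidean_space set \<Rightarrow> 'a \<Rightarrow> 'a set" where
  "torus_proj M' x = (\<lambda>u. x + u) ` M'"

definition torus :: "'a::euclidean_space set \<Rightarrow> 'a set topology" where
  "torus M' = topology (\<lambda>U. U \<subseteq> range (torus_proj M') \<and> open (torus_proj M' -` U))"

lemma openin_torus:
  "openin (torus M') U \<longleftrightarrow> U \<subseteq> range (torus_proj M') \<and> open (torus_proj M' -` U)"
proof -
  have "istopology (\<lambda>U. U \<subseteq> range (torus_proj M') \<and> open (torus_proj M' -` U))"
    unfolding istopology_def
  proof (intro conjI allI impI)
    fix \<K> assume "\<forall>K\<in>\<K>. K \<subseteq> range (torus_proj M') \<and> open (torus_proj M' -` K)"
    then show "\<Union>\<K> \<subseteq> range (torus_proj M')" "open (torus_proj M' -` \<Union>\<K>)"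
      by (auto simp: vimage_Union)
  qed (auto simp: open_Int)
  then show ?thesis
    by (simp add: torus_def topology_inverse')
qed

lemma topspace_torus: "topspace (torus M') = range (torus_proj M')"
proof
  show "topspace (torus M') \<subseteq> range (torus_proj M')"
    unfolding topspace_def openin_torus by blast
  have "openin (torus M') (range (torus_proj M'))"
    unfolding openin_torus by (simp add: vimage_def)
  then show "range (torus_proj M') \<subseteq> topspace (torus M')"
    by (rule openin_subset)
qed

lemma quotient_map_torus_proj: "quotient_map euclidean (torus M') (torus_proj M')"
  by (auto simp: quotient_map_def topspace_torus openin_torus vimage_def)

subsection \<open>Descent data and polarizations\<close>

definition lattice_hom :: "'a::euclidean_space set \<Rightarrow> 'a set \<Rightarrow> ('a \<Rightarrow> 'a) \<Rightarrow> bool" where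
  "lattice_hom M M' lam \<longleftrightarrow>
     lam ` M' \<subseteq> M \<and> (\<forall>u\<in>M'. \<forall>v\<in>M'. lam (u + v) = lam u + lam v)"

definition tropical_descent_datum ::
    "'a::euclidean_space set \<Rightarrow> 'a set \<Rightarrow> ('a \<Rightarrow> 'a) \<Rightarrow> ('a \<Rightarrow> real) \<Rightarrow> bool" where
  "tropical_descent_datum M M' lam \<gamma> \<longleftrightarrow>
     lattice_hom M M' lam \<and>
     (\<forall>u\<in>M'. \<forall>v\<in>M'. \<gamma> (u + v) - \<gamma> u - \<gamma> v = lam v \<bullet> u)"

definition polarization :: "'a::euclidean_space set \<Rightarrow> 'a set \<Rightarrow> ('a \<Rightarrow> 'a) \<Rightarrow> bool" where
  "polarization M M' lam \<longleftrightarrow>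
     lattice_hom M M' lam \<and>
     (\<exists>Q :: 'a \<Rightarrow> 'a \<Rightarrow> real. bilinear Q \<and> (\<forall>x y. Q x y = Q y x) \<and>
        (\<forall>u\<in>M'. \<forall>v\<in>M'. Q u v = lam u \<bullet> v) \<and> (\<forall>x. x \<noteq> 0 \<longrightarrow> Q x x > 0))"

definition tropical_abelian_variety :: "'a::euclidean_space set \<Rightarrow> 'a set \<Rightarrow> bool" where
  "tropical_abelian_variety M M' \<longleftrightarrow>
     full_lattice M \<and> full_lattice M' \<and> (\<exists>lam. polarization M M' lam)"

text \<open>The tropical line bundle \<open>L(lam, \<gamma>)\<close> is represented by its descent datum:\<close>

definition positive_line_bundle ::
    "'a::euclidean_space set \<Rightarrow> 'a set \<Rightarrow> ('a \<Rightarrow> 'a) \<Rightarrow> ('a \<Rightarrow> real) \<Rightarrow> bool" where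
  "positive_line_bundle M M' lam \<gamma> \<longleftrightarrow>
     tropical_descent_datum M M' lam \<gamma> \<and> polarization M M' lam"

definition polarization_type ::
    "'a::euclidean_space set \<Rightarrow> 'a set \<Rightarrow> ('a \<Rightarrow> 'a) \<Rightarrow> (nat \<Rightarrow> nat) \<Rightarrow> bool" where
  "polarization_type M M' lam d \<longleftrightarrow>
     (\<forall>i\<in>{1..DIM('a)}. d i > 0) \<and>
     (\<forall>i\<in>{1..<DIM('a)}. d i dvd d (Suc i)) \<and>
     (\<exists>e f. is_zbasis M' e \<and> is_zbasis M f \<and>
        (\<forall>i\<in>{1..DIM('a)}. lam (e i) = of_nat (d i) *\<^sub>R f i))"

subsection \<open>Theta functions and the induced map\<close>

definition coset_representatives ::
    "'a::euclidean_space set \<Rightarrow> 'a set \<Rightarrow> ('a \<Rightarrow> 'a) \<Rightarrow> nat \<Rightarrow> (nat \<Rightarrow> 'a) \<Rightarrow> bool" where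
  "coset_representatives M M' lam D b \<longleftrightarrow>
     b ` {1..D} \<subseteq> M \<and> (\<forall>u\<in>M. \<exists>!i. i \<in> {1..D} \<and> u - b i \<in> lam ` M')"

text \<open>\<open>LEAST\<close> is the minimum over \<open>u \<in> M'\<close>; it exists when \<open>lam\<close> is a polarization.\<close>

definition theta ::
    "'a::euclidean_space set \<Rightarrow> ('a \<Rightarrow> 'a) \<Rightarrow> ('a \<Rightarrow> real) \<Rightarrow> 'a \<Rightarrow> 'a \<Rightarrow> real" where
  "theta M' lam \<gamma> b x = (LEAST t. \<exists>u\<in>M'. t = (b + lam u) \<bullet> x + \<gamma> u + b \<bullet> u)"

text \<open>
  The point \<open>(t\<^sub>1 : \<dots> : t\<^sub>D)\<close> of \<open>\<real>\<^sup>D / \<real>(1, \<dots>, 1)\<close>, as the point \<open>(t\<^sub>2 - t\<^sub>1, \<dots>, t\<^sub>D - t\<^sub>1)\<close> of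
  \<open>\<real>\<^sup>D\<^sup>-\<^sup>1\<close>. The library's \<open>Euclidean_space m\<close> consists of the functions on \<open>nat\<close> that vanish from
  index \<open>m\<close> on.
\<close>

definition tropical_point :: "nat \<Rightarrow> (nat \<Rightarrow> real) \<Rightarrow> nat \<Rightarrow> real" where
  "tropical_point D t = (\<lambda>i. if i < D - 1 then t (i + 2) - t 1 else 0)"

text \<open>
  A point \<open>c\<close> of the torus is the set of its lifts to \<open>N\<^sub>\<real>\<close>. All of them give the same point of
  \<open>\<real>\<^sup>D / \<real>(1, \<dots>, 1)\<close>, because a translation by \<open>M'\<close> changes all theta functions for \<open>(lam, \<gamma>)\<close> by
  the same summand.
\<close>

definition theta_map ::
    "'a::euclidean_space set \<Rightarrow> ('a \<Rightarrow> 'a) \<Rightarrow> ('a \<Rightarrow> real) \<Rightarrow> nat \<Rightarrow> (nat \<Rightarrow> 'a) \<Rightarrow>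
      'a set \<Rightarrow> nat \<Rightarrow> real" where
  "theta_map M' lam \<gamma> D b c =
     the_elem ((\<lambda>x. tropical_point D (\<lambda>i. theta M' lam \<gamma> (b i) x)) ` c)"

subsection \<open>Unimodular maps and faithful embeddings\<close>

definition rational_polyhedron :: "'a::euclidean_space set \<Rightarrow> 'a set \<Rightarrow> bool" where
  "rational_polyhedron M P \<longleftrightarrow>
     (\<exists>F :: ('a \<times> real) set. finite F \<and> F \<subseteq> M \<times> UNIV \<and> P = {x. \<forall>(u, b)\<in>F. u \<bullet> x \<ge> b})"

text \<open>In the library, the empty set is a face of every set, so disjoint cells are allowed.\<close>

definition rational_polyhedral_decomposition ::
    "'a::euclidean_space set \<Rightarrow> 'a set set \<Rightarrow> bool" where
  "rational_polyhedral_decomposition M \<C> \<longleftrightarrow>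
     (\<forall>P\<in>\<C>. rational_polyhedron M P \<and> P \<noteq> {}) \<and>
     (\<forall>P\<in>\<C>. \<forall>F. F face_of P \<and> F \<noteq> {} \<longrightarrow> F \<in> \<C>) \<and>
     (\<forall>P\<in>\<C>. \<forall>P'\<in>\<C>. P \<inter> P' face_of P \<and> P \<inter> P' face_of P') \<and>
     locally_finite_in euclidean \<C> \<and>
     \<Union>\<C> = UNIV"

definition int_points :: "nat \<Rightarrow> (nat \<Rightarrow> real) set" where
  "int_points m = {v \<in> topspace (Euclidean_space m). \<forall>i. v i \<in> \<int>}"

text \<open>
  A linear map \<open>N\<^sub>\<real> \<rightarrow> \<real>\<^sup>m\<close> that extends an injective homomorphism \<open>N \<rightarrow> \<int>\<^sup>m\<close> with torsion-free
  cokernel: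
\<close>

definition unimodular_linear ::
    "'a::euclidean_space set \<Rightarrow> nat \<Rightarrow> ('a \<Rightarrow> nat \<Rightarrow> real) \<Rightarrow> bool" where
  "unimodular_linear M m A \<longleftrightarrow>
     (\<forall>i. linear (\<lambda>x. A x i)) \<and>
     A ` dual_lattice M \<subseteq> int_points m \<and>
     inj_on A (dual_lattice M) \<and>
     (\<forall>v\<in>int_points m. \<forall>k::int. k \<noteq> 0 \<and> (\<lambda>i. of_int k * v i) \<in> A ` dual_lattice M
        \<longrightarrow> v \<in> A ` dual_lattice M)"

definition unimodular ::
    "'a::euclidean_space set \<Rightarrow> 'a set \<Rightarrow> nat \<Rightarrow> ('a set \<Rightarrow> nat \<Rightarrow> real) \<Rightarrow> bool" where
  "unimodular M M' m \<phi> \<longleftrightarrow>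
     (\<exists>\<C>. rational_polyhedral_decomposition M \<C> \<and>
        (\<forall>P\<in>\<C>. \<exists>A. \<exists>a\<in>topspace (Euclidean_space m). unimodular_linear M m A \<and>
           (\<forall>x\<in>P. \<phi> (torus_proj M' x) = (\<lambda>i. A x i + a i))))"

text \<open>\<open>embedding_map\<close> is the library's notion of a homeomorphism onto the image.\<close>

definition faithful_embedding ::
    "'a::euclidean_space set \<Rightarrow> 'a set \<Rightarrow> nat \<Rightarrow> ('a set \<Rightarrow> nat \<Rightarrow> real) \<Rightarrow> bool" where
  "faithful_embedding M M' m \<phi> \<longleftrightarrow>
     unimodular M M' m \<phi> \<and> embedding_map (torus M') (Euclidean_space m) \<phi>"

end

theory Submission
  imports Defs
begin

text \<open>
  Completing the square turns each theta function, up to summands that do not depend on the class of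
  \<open>b\<close> or on \<open>x\<close>, into half the squared \<open>Q\<close>-distance from a point to a class of \<open>K\<close> modulo \<open>M'\<close>,
  where \<open>K\<close> is the lattice \<open>M\<close> seen through the polarization, and \<open>M' \<subseteq> d\<^sub>1 K\<close>.

  For \<open>d\<^sub>1 \<ge> 3\<close>, the differences of these distances determine the point: a shortest vector of \<open>K\<close> that
  separates two points of the Voronoi cell of \<open>K\<close> is closest to both of them in its class.

  For \<open>d\<^sub>1 \<ge> 2\<close>, the slopes on a common linearity domain are given by points of \<open>K\<close> closest to a fixed
  point in their classes, and descent on the distance shows that these generate \<open>K\<close> affinely. This is
  dual to unimodularity.
\<close>

subsection \<open>Lattice coordinates\<close>

text \<open>The \<open>g i\<close> form the basis dual to \<open>e\<close> for the inner product, so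
  membership in the lattice becomes integrality of coordinates.\<close>

lemma zbasis_coordinates:
  fixes L :: "'a::euclidean_space set"
  assumes "is_zbasis L e"
  obtains g where "\<And>x. (\<Sum>i=1..DIM('a). (x \<bullet> g i) *\<^sub>R e i) = x"
    and "L = {x. \<forall>i\<in>{1..DIM('a)}. x \<bullet> g i \<in> \<int>}"
    and "\<And>i. i \<in> {1..DIM('a)} \<Longrightarrow> e i \<in> L"
proof -
  let ?I = "{1..DIM('a)}"
  have inj: "inj_on e ?I" and ind: "independent (e ` ?I)"
    and L: "L = {\<Sum>i\<in>?I. of_int (c i) *\<^sub>R e i | c :: nat \<Rightarrow> int. True}"
    using assms by (auto simp: is_zbasis_def)
  have "\<exists>h. \<forall>j\<in>?I. e j \<bullet> h = (if j = i then 1 else 0)" for i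
  proof -
    obtain k :: "'a \<Rightarrow> real" where k: "linear k"
        "\<forall>x\<in>e ` ?I. k x = (if x = e i then 1 else 0)"
      using linear_independent_extend[OF ind, of "\<lambda>x. if x = e i then 1 else 0"] by auto
    show ?thesis
    proof (cases "i \<in> ?I")
      case True
      have "e j \<bullet> adjoint k 1 = (if j = i then 1 else 0)" if "j \<in> ?I" for j
      proof -
        have "e j = e i \<longleftrightarrow> j = i"
          using inj_on_eq_iff[OF inj that True] .
        then show ?thesis
          using k that by (auto simp: adjoint_works)
      qed
      then show ?thesis by blast
    next
      case False
      \<comment> \<open>Outside the index range 0 is a default value that makes \<open>g\<close> a
        total function.\<close>
      then have "\<forall>j\<in>?I. e j \<bullet> 0 = (if j = i then 1 else 0)" by auto
      then show ?thesis by blast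
    qed
  qed
  then obtain g where g: "\<And>i j. j \<in> ?I \<Longrightarrow> e j \<bullet> g i = (if j = i then 1 else 0)"
    by metis
  have "card (e ` ?I) = DIM('a)" using inj by (simp add: card_image)
  then have span: "span (e ` ?I) = UNIV"
    using card_ge_dim_independent[of "e ` ?I" UNIV] ind by auto
  have co: "(\<Sum>i\<in>?I. t i *\<^sub>R e i) \<bullet> g j = t j" if "j \<in> ?I" for t j
    using that by (simp add: inner_sum_left g if_distrib cong: if_cong)
  have repr: "(\<Sum>i\<in>?I. (x \<bullet> g i) *\<^sub>R e i) = x" for x
  proof -
    have "linear (\<lambda>x. \<Sum>i\<in>?I. (x \<bullet> g i) *\<^sub>R e i)"
      by (intro linear_compose_sum ballI linearI) (auto simp: inner_add_left scaleR_add_left)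
    moreover have "(\<Sum>i\<in>?I. (e j \<bullet> g i) *\<^sub>R e i) = e j" if "j \<in> ?I" for j
    proof -
      have "(\<Sum>i\<in>?I. (e j \<bullet> g i) *\<^sub>R e i) = (\<Sum>i\<in>?I. if j = i then e i else 0)"
        using that g by (intro sum.cong) auto
      then show ?thesis using that by simp
    qed
    ultimately show ?thesis
      using linear_eq_on_span[OF _ linear_id, of "\<lambda>x. \<Sum>i\<in>?I. (x \<bullet> g i) *\<^sub>R e i" "e ` ?I" x] span
      by (fastforce simp: id_def)
  qed
  have "L = {x. \<forall>i\<in>?I. x \<bullet> g i \<in> \<int>}"
  proof (intro equalityI subsetI)
    fix x assume "x \<in> L"
    then show "x \<in> {x. \<forall>i\<in>?I. x \<bullet> g i \<in> \<int>}"
      using co by (auto simp: L)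
  next
    fix x assume "x \<in> {x. \<forall>i\<in>?I. x \<bullet> g i \<in> \<int>}"
    then have "(\<Sum>i\<in>?I. of_int \<lfloor>x \<bullet> g i\<rfloor> *\<^sub>R e i) = (\<Sum>i\<in>?I. (x \<bullet> g i) *\<^sub>R e i)"
      by (intro sum.cong) auto
    then have "x = (\<Sum>i\<in>?I. of_int \<lfloor>x \<bullet> g i\<rfloor> *\<^sub>R e i)"
      using repr[of x] by simp
    then show "x \<in> L" unfolding L by (intro CollectI exI[of _ "\<lambda>i. \<lfloor>x \<bullet> g i\<rfloor>"]) simp
  qed
  moreover from this have "e i \<in> L" if "i \<in> ?I" for i
    using that by (auto simp: g)
  ultimately show ?thesis using that[of g] repr by blast
qed

text \<open>That vectors generate a lattice is expressed below by quantifying over all subgroups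
  that contain them.\<close>

definition subgroup_set :: "'a::ab_group_add set \<Rightarrow> bool" where
  "subgroup_set S \<longleftrightarrow> 0 \<in> S \<and> (\<forall>x\<in>S. \<forall>y\<in>S. x - y \<in> S)"

lemma subgroup_setD:
  assumes "subgroup_set S"
  shows "0 \<in> S" "x \<in> S \<Longrightarrow> y \<in> S \<Longrightarrow> x - y \<in> S" "x \<in> S \<Longrightarrow> - x \<in> S"
    "x \<in> S \<Longrightarrow> y \<in> S \<Longrightarrow> x + y \<in> S"
proof -
  show 0: "0 \<in> S" and d: "x \<in> S \<Longrightarrow> y \<in> S \<Longrightarrow> x - y \<in> S" for x y
    using assms by (auto simp: subgroup_set_def)
  show m: "x \<in> S \<Longrightarrow> - x \<in> S" for x using d[OF 0, of x] by simp
  show "x \<in> S \<Longrightarrow> y \<in> S \<Longrightarrow> x + y \<in> S" using d[OF _ m[of y], of x] by simp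
qed

lemma full_lattice_subgroup:
  assumes "full_lattice (L :: 'a::euclidean_space set)"
  shows "subgroup_set L"
proof -
  obtain e where e: "is_zbasis L e" using assms by (auto simp: full_lattice_def)
  obtain g where L: "L = {x. \<forall>i\<in>{1..DIM('a)}. x \<bullet> g i \<in> \<int>}"
    by (rule zbasis_coordinates[OF e]) (rule that)
  show ?thesis
    unfolding L by (auto simp: subgroup_set_def inner_diff_left)
qed

lemma subgroup_set_scale_int:
  fixes x :: "'a::real_vector"
  assumes "subgroup_set S" "x \<in> S"
  shows "of_int k *\<^sub>R x \<in> S"
proof -
  have n: "of_nat n *\<^sub>R x \<in> S" for n
    using assms by (induction n) (auto simp: scaleR_add_left dest: subgroup_setD)
  show ?thesis
    using n[of "nat k"] subgroup_setD(3)[OF assms(1) n[of "nat (- k)"]]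
    by (cases "k \<ge> 0") auto
qed

lemma zbasis_subset_subgroup:
  fixes L :: "'a::euclidean_space set"
  assumes "is_zbasis L e" "subgroup_set S" "\<And>i. i \<in> {1..DIM('a)} \<Longrightarrow> e i \<in> S"
  shows "L \<subseteq> S"
proof -
  have "(\<Sum>i\<in>J. of_int (c i) *\<^sub>R e i) \<in> S" if "J \<subseteq> {1..DIM('a)}" for c J
    using finite_subset[OF that finite_atLeastAtMost] that
    by (induction J rule: finite_induct)
      (auto intro!: subgroup_setD(1,4)[OF assms(2)] subgroup_set_scale_int assms)
  then show ?thesis using assms(1) by (auto simp: is_zbasis_def)
qed

lemma full_lattice_eq_on:
  fixes L :: "'a::euclidean_space set" and f g :: "'a \<Rightarrow> 'b::real_vector"
  assumes "full_lattice L" "linear f" "linear g" "\<And>x. x \<in> L \<Longrightarrow> f x = g x"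
  shows "f = g"
proof
  fix x
  obtain e where e: "is_zbasis L e" using assms(1) by (auto simp: full_lattice_def)
  obtain h where h: "\<And>x. (\<Sum>i=1..DIM('a). (x \<bullet> h i) *\<^sub>R e i) = x"
    and L: "\<And>i. i \<in> {1..DIM('a)} \<Longrightarrow> e i \<in> L"
    by (rule zbasis_coordinates[OF e]) (rule that)
  have "f x = (\<Sum>i=1..DIM('a). (x \<bullet> h i) *\<^sub>R f (e i))"
    by (subst h[of x, symmetric]) (simp add: assms linear_sum linear_scale)
  moreover have "g x = (\<Sum>i=1..DIM('a). (x \<bullet> h i) *\<^sub>R g (e i))"
    by (subst h[of x, symmetric]) (simp add: assms linear_sum linear_scale)
  ultimately show "f x = g x" using L assms(4) by simp
qed

lemma full_lattice_orthogonal: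
  fixes z :: "'a::euclidean_space"
  assumes "full_lattice L" "\<And>u. u \<in> L \<Longrightarrow> u \<bullet> z = 0"
  shows "z = 0"
proof -
  have "(\<lambda>u. u \<bullet> z) = (\<lambda>u. 0)"
    by (rule full_lattice_eq_on[OF assms(1)]) (auto simp: assms intro!: linearI inner_add_left)
  then have "z \<bullet> z = 0" by meson
  then show ?thesis by simp
qed

text \<open>The values on a basis extend to a linear functional, and the points where
  \<open>h\<close> agrees with it form a subgroup containing the basis. This serves to extract the
  linear part of \<open>\<gamma>\<close>.\<close>

lemma full_lattice_additive:
  fixes L :: "'a::euclidean_space set" and h :: "'a \<Rightarrow> real"
  assumes "full_lattice L" "\<And>u v. u \<in> L \<Longrightarrow> v \<in> L \<Longrightarrow> h (u + v) = h u + h v"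
  obtains a where "\<And>u. u \<in> L \<Longrightarrow> h u = a \<bullet> u"
proof -
  obtain e where e: "is_zbasis L e" using assms(1) by (auto simp: full_lattice_def)
  have eL: "e i \<in> L" if "i \<in> {1..DIM('a)}" for i
    using that by (auto intro: zbasis_coordinates[OF e])
  obtain k :: "'a \<Rightarrow> real" where k: "linear k" "\<forall>x\<in>e ` {1..DIM('a)}. k x = h x"
    using linear_independent_extend[of "e ` {1..DIM('a)}" h] e by (auto simp: is_zbasis_def)
  note sg = full_lattice_subgroup[OF assms(1)]
  have "subgroup_set {u\<in>L. h u = k u}"
    unfolding subgroup_set_def
  proof (intro conjI ballI; clarsimp)
    show "0 \<in> L \<and> h 0 = k 0"
      using subgroup_setD(1)[OF sg] assms(2)[of 0 0] linear_0[OF k(1)] by simp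
    fix x y assume "x \<in> L" "y \<in> L" "h x = k x" "h y = k y"
    then show "x - y \<in> L \<and> h (x - y) = k (x - y)"
      using assms(2)[of "x - y" y] subgroup_setD(2)[OF sg] linear_diff[OF k(1)] by simp
  qed
  then have "L \<subseteq> {u\<in>L. h u = k u}"
    using zbasis_subset_subgroup[OF e] eL k(2) by (metis (mono_tags, lifting) imageI mem_Collect_eq)
  moreover have "k u = adjoint k 1 \<bullet> u" for u
    using adjoint_works[OF k(1), of u 1] by (simp add: inner_commute)
  ultimately show ?thesis using that[of "adjoint k 1"] by auto
qed

text \<open>Rounding the coordinates down leaves a point of the fundamental parallelepiped. The
  bound gives both boundedness of the Voronoi cell and compactness of the torus.\<close>

lemma full_lattice_covering:
  fixes L :: "'a::euclidean_space set"
  assumes "full_lattice L"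
  obtains R where "\<And>x. \<exists>u\<in>L. norm (x + u) \<le> R"
proof -
  obtain e where e: "is_zbasis L e" using assms(1) by (auto simp: full_lattice_def)
  obtain g where g: "\<And>x. (\<Sum>i=1..DIM('a). (x \<bullet> g i) *\<^sub>R e i) = x"
    by (rule zbasis_coordinates[OF e]) (rule that)
  have L: "L = {\<Sum>i=1..DIM('a). of_int (c i) *\<^sub>R e i | c :: nat \<Rightarrow> int. True}"
    using e by (simp add: is_zbasis_def)
  have "\<exists>u\<in>L. norm (x + u) \<le> (\<Sum>i=1..DIM('a). norm (e i))" for x
  proof (intro bexI)
    show "(\<Sum>i=1..DIM('a). of_int (- \<lfloor>x \<bullet> g i\<rfloor>) *\<^sub>R e i) \<in> L"
      unfolding L by (intro CollectI exI[of _ "\<lambda>i. - \<lfloor>x \<bullet> g i\<rfloor>"]) simp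
    have "x + (\<Sum>i=1..DIM('a). of_int (- \<lfloor>x \<bullet> g i\<rfloor>) *\<^sub>R e i)
        = (\<Sum>i=1..DIM('a). frac (x \<bullet> g i) *\<^sub>R e i)"
      by (subst (1) g[of x, symmetric]) (simp add: frac_def algebra_simps sum_negf sum_subtractf)
    then show "norm (x + (\<Sum>i=1..DIM('a). of_int (- \<lfloor>x \<bullet> g i\<rfloor>) *\<^sub>R e i))
        \<le> (\<Sum>i=1..DIM('a). norm (e i))"
      by (auto intro!: sum_norm_le mult_left_le_one_le frac_ge_0 less_imp_le[OF frac_lt_1])
  qed
  then show ?thesis using that by blast
qed

subsection \<open>The Voronoi cell of a polarized lattice\<close>

text \<open>\<open>P\<close> is the real-linear extension of the polarization, and \<open>c\<close> represents the linear part of \<open>\<gamma>\<close>.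
  Pulling \<open>M\<close> back along \<open>P\<close> makes it a lattice \<open>K \<supseteq> M'\<close> in the space that carries \<open>Q\<close>.\<close>

locale polarized =
  fixes P :: "'a::euclidean_space \<Rightarrow> 'a" and M M' :: "'a set" and c :: 'a
  assumes P: "linear P" and P_sym: "P x \<bullet> y = P y \<bullet> x" and P_pos: "x \<noteq> 0 \<Longrightarrow> P x \<bullet> x > 0"
    and M: "full_lattice M" and M': "full_lattice M'" and P_M': "P ` M' \<subseteq> M"
begin

definition Q :: "'a \<Rightarrow> 'a \<Rightarrow> real" where "Q x y = P x \<bullet> y"

definition q :: "'a \<Rightarrow> real" where "q x = Q x x"

definition K :: "'a set" where "K = P -` M"

text \<open>The Voronoi cell around 0 of the sublattice \<open>M'\<close>, not of
  \<open>K\<close>.\<close>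

definition V :: "'a set" where "V = {y. \<forall>v\<in>M'. q y \<le> q (y + v)}"

lemma Q_simps:
  "Q (x + y) z = Q x z + Q y z" "Q x (y + z) = Q x y + Q x z"
  "Q (x - y) z = Q x z - Q y z" "Q x (y - z) = Q x y - Q x z"
  "Q (t *\<^sub>R x) y = t * Q x y" "Q x (t *\<^sub>R y) = t * Q x y"
  "Q (- x) y = - Q x y" "Q x (- y) = - Q x y"
  by (simp_all add: Q_def linear_add[OF P] linear_diff[OF P] linear_scale[OF P] linear_neg[OF P]
      inner_simps)

lemma Q_sym: "Q x y = Q y x"
  by (simp add: Q_def P_sym)

lemma q_add: "q (x + y) = q x + q y + 2 * Q x y"
  by (simp add: q_def Q_simps Q_sym[of y x])

lemma q_diff: "q (x - y) = q x + q y - 2 * Q x y"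
  by (simp add: q_def Q_simps Q_sym[of y x])

lemma q_scale: "q (t *\<^sub>R x) = t\<^sup>2 * q x"
  by (simp add: q_def Q_simps power2_eq_square)

lemma q_pos: "x \<noteq> 0 \<Longrightarrow> q x > 0"
  by (simp add: q_def Q_def P_pos)

lemma q_zero: "q 0 = 0"
  by (simp add: q_def Q_def)

lemma q_nonneg: "q x \<ge> 0"
  using q_pos[of x] q_zero by (cases "x = 0") auto

lemma q_bound: obtains C where "\<And>x r. norm x \<le> r \<Longrightarrow> q x \<le> C * r\<^sup>2"
proof -
  obtain B where B: "B > 0" "\<And>x. norm (P x) \<le> B * norm x"
    using linear_bounded_pos[OF P] by blast
  have "q x \<le> B * r\<^sup>2" if "norm x \<le> r" for x r
  proof -
    have "q x \<le> norm (P x) * norm x"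
      by (simp add: q_def Q_def norm_cauchy_schwarz)
    also have "\<dots> \<le> (B * norm x) * norm x"
      using B by (intro mult_right_mono) auto
    also have "\<dots> = B * (norm x)\<^sup>2" by (simp add: power2_eq_square)
    also have "\<dots> \<le> B * r\<^sup>2"
      using B that by (intro mult_left_mono power_mono) auto
    finally show ?thesis .
  qed
  then show ?thesis using that by blast
qed

lemma P_inj: "inj P"
proof -
  have "x = 0" if "P x = 0" for x
    using P_pos[of x] that by force
  then show ?thesis by (simp add: linear_injective_0[OF P])
qed

lemma P_surj: "\<exists>y. P y = x"
  using linear_injective_imp_surjective[OF P P_inj] by (metis surjD)

section \<open>Finiteness and nearest points in \<open>K\<close>\<close>

lemma K_subgroup: "subgroup_set K"
  using full_lattice_subgroup[OF M]
  by (auto simp: K_def subgroup_set_def linear_0[OF P] linear_diff[OF P])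

lemma M'_subgroup: "subgroup_set M'"
  by (rule full_lattice_subgroup[OF M'])

lemmas K_closed = subgroup_setD[OF K_subgroup]
lemmas M'_closed = subgroup_setD[OF M'_subgroup]

lemma M'_subset_K: "u \<in> M' \<Longrightarrow> u \<in> K"
  using P_M' by (auto simp: K_def)

lemma finite_q_le: "finite {x \<in> K. q x \<le> r}"
proof -
  let ?I = "{1..DIM('a)}"
  obtain e where e: "is_zbasis M e" using M by (auto simp: full_lattice_def)
  obtain g where g: "\<And>x. (\<Sum>i\<in>?I. (x \<bullet> g i) *\<^sub>R e i) = x"
    and M_eq: "M = {x. \<forall>i\<in>?I. x \<bullet> g i \<in> \<int>}"
    by (rule zbasis_coordinates[OF e]) (rule that)
  define co where "co x = restrict (\<lambda>i. P x \<bullet> g i) ?I" for x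
  have "inj co"
  proof (rule injI)
    fix x y assume "co x = co y"
    then have "P x \<bullet> g i = P y \<bullet> g i" if "i \<in> ?I" for i
      using that unfolding co_def by (metis restrict_apply')
    then have "P x = P y"
      using g[of "P x"] g[of "P y"] by simp
    then show "x = y" using P_inj by (simp add: inj_eq)
  qed
  moreover have "co x \<in> (\<Pi>\<^sub>E i\<in>?I. {t \<in> \<int>. \<bar>t\<bar> \<le> (r + q (g i)) / 2})" if "x \<in> K" "q x \<le> r" for x
  proof -
    \<comment> \<open>Expanding \<open>q (x + y)\<close> and \<open>q (x - y)\<close>, both
      nonnegative, bounds the integer coordinates of \<open>P x\<close>.\<close>
    have "\<bar>P x \<bullet> y\<bar> \<le> (r + q y) / 2" for y
      using q_nonneg[of "x + y"] q_nonneg[of "x - y"] that(2)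
      by (auto simp: q_add q_diff Q_def abs_le_iff)
    then show ?thesis
      using that(1) by (auto simp: co_def K_def) (simp add: M_eq)
  qed
  moreover have "finite (\<Pi>\<^sub>E i\<in>?I. {t \<in> \<int>. \<bar>t :: real\<bar> \<le> (r + q (g i)) / 2})"
    by (intro finite_PiE finite_abs_int_segment) auto
  ultimately show ?thesis
    by (intro inj_on_finite[of co]) (auto intro: inj_on_subset)
qed

lemma finite_q_shift_le: "finite {k \<in> K. q (s + k) \<le> r}"
proof -
  \<comment> \<open>Parallelogram law for \<open>s + k\<close> and \<open>s\<close>.\<close>
  have "q k \<le> 2 * r + 2 * q s" if "q (s + k) \<le> r" for k
    using that q_nonneg[of "s + (s + k)"] q_add[of s "s + k"] q_add[of s k]
    by (simp add: Q_simps q_def)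
  then show ?thesis
    by (intro finite_subset[OF _ finite_q_le[of "2 * r + 2 * q s"]]) auto
qed

text \<open>Only finitely many elements are as close as a given one. Besides nearest points, this
  supplies the minimal counterexamples of the descent arguments.\<close>

lemma exists_nearest:
  assumes "X \<subseteq> K" "X \<noteq> {}"
  obtains k where "k \<in> X" "\<And>k'. k' \<in> X \<Longrightarrow> q (s + k) \<le> q (s + k')"
proof -
  obtain x where x: "x \<in> X" using assms by blast
  let ?F = "{k \<in> X. q (s + k) \<le> q (s + x)}"
  have F: "finite ?F" "?F \<noteq> {}"
    using x assms(1) by (auto intro: finite_subset[OF _ finite_q_shift_le[of s "q (s + x)"]])
  define k where "k = arg_min_on (\<lambda>k. q (s + k)) ?F"
  have k: "k \<in> ?F" "\<And>k'. k' \<in> ?F \<Longrightarrow> q (s + k) \<le> q (s + k')"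
    using arg_min_if_finite[OF F, of "\<lambda>k. q (s + k)"] by (auto simp: k_def not_less)
  show ?thesis
  proof (rule that)
    show "k \<in> X" using k(1) by simp
    show "q (s + k) \<le> q (s + k')" if "k' \<in> X" for k'
      using k(1) k(2)[of k'] that by (cases "q (s + k') \<le> q (s + x)") auto
  qed
qed

section \<open>The Voronoi cell of \<open>M'\<close> as a compact polytope\<close>

lemma V_exists: obtains u where "u \<in> M'" "y + u \<in> V"
proof -
  have sub: "M' \<subseteq> K" and ne: "M' \<noteq> {}"
    using M'_subset_K M'_closed(1) by auto
  obtain u where u: "u \<in> M'" "\<And>v. v \<in> M' \<Longrightarrow> q (y + u) \<le> q (y + v)"
    using exists_nearest[OF sub ne] by blast
  then have "y + u \<in> V"
    using M'_closed(4) by (auto simp: V_def add.assoc)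
  then show ?thesis using that u by blast
qed

lemma V_iff: "y \<in> V \<longleftrightarrow> (\<forall>v\<in>M'. 0 \<le> q v + 2 * Q v y)"
  by (simp add: V_def q_add Q_sym[of y])

lemma V_translate: "y \<in> V \<Longrightarrow> y' - y \<in> M' \<Longrightarrow> q y \<le> q y'"
proof -
  assume "y \<in> V" "y' - y \<in> M'"
  then have "q y \<le> q (y + (y' - y))" unfolding V_def by blast
  then show ?thesis by simp
qed

lemma V_same_q: "y \<in> V \<Longrightarrow> y' - y \<in> M' \<Longrightarrow> q y' = q y \<Longrightarrow> y' \<in> V"
proof -
  assume a: "y \<in> V" "y' - y \<in> M'" "q y' = q y"
  then have "q y \<le> q (y' + v)" if "v \<in> M'" for v
    using V_translate[of y "y' + v"] M'_closed(4)[of "y' - y" v] that by (simp add: algebra_simps)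
  then show ?thesis using a by (simp add: V_def)
qed

text \<open>Some translate of \<open>y\<close> by \<open>M'\<close> lies in a fixed ball, and its
  \<open>q\<close> is at least that of \<open>y\<close>.\<close>

lemma V_bounded: obtains R where "\<And>y. y \<in> V \<Longrightarrow> q y \<le> R"
proof -
  obtain r where r: "\<And>x. \<exists>u\<in>M'. norm (x + u) \<le> r"
    using full_lattice_covering[OF M'] by blast
  obtain C where C: "\<And>x r. norm x \<le> r \<Longrightarrow> q x \<le> C * r\<^sup>2" using q_bound by blast
  have "q y \<le> C * r\<^sup>2" if y: "y \<in> V" for y
  proof -
    obtain u where "u \<in> M'" "norm (y + u) \<le> r" using r by blast
    then show ?thesis using y C[of "y + u" r] by (force simp: V_def)
  qed
  then show ?thesis using that by blast
qed

text \<open>A violated inequality of minimal length is given by a vector that is shortest modulo \<open>2M'\<close>;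
  half of such a vector lies in \<open>V\<close>, which bounds its length.\<close>

lemma V_finite:
  obtains F where "finite F" "F \<subseteq> M'" "\<And>y. y \<in> V \<longleftrightarrow> (\<forall>v\<in>F. 0 \<le> q v + 2 * Q v y)"
proof -
  obtain R where R: "\<And>y. y \<in> V \<Longrightarrow> q y \<le> R" using V_bounded by blast
  let ?F = "{v\<in>M'. q v \<le> 4 * R}"
  have "y \<in> V" if y: "\<And>v. v \<in> ?F \<Longrightarrow> 0 \<le> q v + 2 * Q v y" for y
  proof (rule ccontr)
    assume "y \<notin> V"
    then have ne: "{v\<in>M'. q v + 2 * Q v y < 0} \<noteq> {}" by (auto simp: V_iff not_le)
    have sub: "{v\<in>M'. q v + 2 * Q v y < 0} \<subseteq> K" using M'_subset_K by auto
    obtain v where v: "v \<in> M'" "q v + 2 * Q v y < 0"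
      and vmin: "\<And>w. w \<in> M' \<Longrightarrow> q w + 2 * Q w y < 0 \<Longrightarrow> q v \<le> q w"
      using exists_nearest[OF sub ne, of 0] by (metis (mono_tags, lifting) add_0 mem_Collect_eq)
    have "(1/2) *\<^sub>R v \<in> V"
      unfolding V_iff
    proof (intro ballI, rule ccontr)
      fix w assume w: "w \<in> M'" and neg: "\<not> 0 \<le> q w + 2 * Q w ((1/2) *\<^sub>R v)"
      have "q w \<ge> 0" "q (w + v) \<ge> 0" by (rule q_nonneg)+
      \<comment> \<open>Thus \<open>v\<close> is the sum of the shorter vectors \<open>w + v\<close>
        and \<open>- w\<close>. Both satisfy their inequalities at \<open>y\<close>, and adding
        these contradicts the violation by \<open>v\<close>.\<close>
      then have lt: "q (w + v) + q w < q v" using neg by (simp add: q_add Q_simps)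
      have "0 \<le> q (w + v) + 2 * Q (w + v) y"
        using vmin[of "w + v"] lt w v(1) M'_closed(4) q_nonneg[of w] by force
      moreover have "0 \<le> q (- w) + 2 * Q (- w) y"
        using vmin[of "- w"] lt w M'_closed(3) q_nonneg[of "w + v"] by (force simp: q_def Q_simps)
      ultimately show False
        using v(2) lt by (simp add: q_def Q_simps)
    qed
    \<comment> \<open>The factor 4 is due to halving \<open>v\<close>, since \<open>q\<close> is
      quadratic.\<close>
    then have "q v \<le> 4 * R"
      using R by (force simp: q_scale power2_eq_square)
    then show False using y[of v] v by force
  qed
  moreover have "finite ?F"
    using M'_subset_K by (auto intro: finite_subset[OF _ finite_q_le[of "4 * R"]])
  ultimately show ?thesis
    by (intro that[of ?F]) (auto simp: V_iff)
qed

lemma V_closed: "closed V"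
proof -
  have "V = (\<Inter>v\<in>M'. {y. 0 \<le> q v + 2 * (P v \<bullet> y)})"
    by (auto simp: V_iff Q_def)
  then show ?thesis
    by (auto intro!: closed_INT closed_Collect_le continuous_intros)
qed

lemma V_convex_combination:
  assumes "x \<in> V" "y \<in> V" "0 \<le> t" "0 \<le> s" "s + t = 1"
  shows "s *\<^sub>R x + t *\<^sub>R y \<in> V"
proof -
  have "0 \<le> q v + 2 * Q v (s *\<^sub>R x + t *\<^sub>R y)" if "v \<in> M'" for v
  proof -
    have "0 \<le> s * (q v + 2 * Q v x) + t * (q v + 2 * Q v y)"
      using assms that by (auto simp: V_iff)
    also have "\<dots> = (s + t) * q v + 2 * Q v (s *\<^sub>R x + t *\<^sub>R y)"
      by (simp add: Q_simps algebra_simps)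
    finally show ?thesis using assms by simp
  qed
  then show ?thesis by (simp add: V_iff)
qed

subsection \<open>Distances to the classes of \<open>K\<close> modulo \<open>M'\<close>\<close>

text \<open>The squared \<open>Q\<close>-distance from \<open>y\<close> to \<open>M'\<close>, with
  \<open>LEAST\<close> as in \<open>theta\<close>. The minimum is attained by
  \<open>V_exists\<close> and \<open>\<delta>_eq\<close>.\<close>

definition \<delta> :: "'a \<Rightarrow> real" where "\<delta> y = (LEAST t. \<exists>u\<in>M'. t = q (y + u))"

lemma \<delta>_eq: "u \<in> M' \<Longrightarrow> y + u \<in> V \<Longrightarrow> \<delta> y = q (y + u)"
  unfolding \<delta>_def
  by (rule Least_equality) (auto intro!: V_translate dest: M'_closed(2))

lemma \<delta>_le: "u \<in> M' \<Longrightarrow> \<delta> y \<le> q (y + u)"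
proof -
  assume u: "u \<in> M'"
  obtain v where "v \<in> M'" "y + v \<in> V" using V_exists by blast
  then show ?thesis
    using \<delta>_eq[of v y] V_translate[of "y + v" "y + u"] u M'_closed(2) by simp
qed

lemma \<delta>_periodic: "u \<in> M' \<Longrightarrow> \<delta> (y + u) = \<delta> y"
proof -
  assume u: "u \<in> M'"
  obtain v where "v \<in> M'" "y + v \<in> V" using V_exists by blast
  then show ?thesis
    using \<delta>_eq[of v y] \<delta>_eq[of "v - u" "y + u"] u M'_closed(2) by simp
qed

text \<open>After translation, both points lie in the Voronoi cell of \<open>K\<close>. A shortest \<open>k\<close> in \<open>K\<close> that separates
  them is shortest modulo \<open>2K\<close>, and hence for \<open>d \<ge> 3\<close> realizes the distance to its class modulo
  \<open>M'\<close> from both points.\<close>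

lemma \<delta>_injective:
  assumes d: "d \<ge> (3::nat)" and M'_d: "\<And>u. u \<in> M' \<Longrightarrow> \<exists>w\<in>K. u = of_nat d *\<^sub>R w"
    and eq: "\<And>k. k \<in> K \<Longrightarrow> \<delta> (y + k) - \<delta> (y' + k) = \<kappa>"
  shows "y - y' \<in> M'"
proof -
  obtain p where p: "p \<in> K" "\<And>k. k \<in> K \<Longrightarrow> q (y + p) \<le> q (y + k)"
    using exists_nearest[OF order_refl, of y] K_closed(1) by auto
  \<comment> \<open>At first \<open>Y'\<close> is placed only in the larger cell of
    \<open>M'\<close>; that it lies in the cell of \<open>K\<close> follows from the hypothesis on
    differences.\<close>
  obtain u where u: "u \<in> M'" "y' + p + u \<in> V" using V_exists by blast
  define Y Y' where "Y = y + p" and "Y' = y' + p + u"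
  have Y: "q Y \<le> q (Y + k)" if "k \<in> K" for k
    using p K_closed(4)[OF p(1) that] by (auto simp: Y_def add.assoc)
  have qY: "\<delta> Y = q Y"
    using \<delta>_eq[OF M'_closed(1), of Y] Y M'_subset_K by (auto simp: V_def)
  have qY': "\<delta> Y' = q Y'"
    using \<delta>_eq[OF M'_closed(1), of Y'] u(2) by (auto simp: Y'_def)
  have eqY: "\<delta> (Y + k) - \<delta> (Y' + k) = \<kappa>" if "k \<in> K" for k
  proof -
    have "\<delta> (Y' + k) = \<delta> (y' + (p + k))"
      using \<delta>_periodic[OF u(1), of "y' + (p + k)"] by (simp add: Y'_def algebra_simps)
    then show ?thesis using eq[of "p + k"] K_closed(4)[OF p(1) that] by (simp add: Y_def algebra_simps)
  qed
  \<comment> \<open>Among the translates by \<open>K\<close>, \<open>\<delta>\<close> is minimal at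
    \<open>Y\<close>. By \<open>eqY\<close> the values at the translates of \<open>Y'\<close> differ
    from these by a constant, so minimality carries over.\<close>
  have Y': "q Y' \<le> q (Y' + k)" if k: "k \<in> K" for k
  proof -
    have "\<delta> Y \<le> \<delta> (Y + k)"
    proof -
      obtain v where v: "v \<in> M'" "Y + k + v \<in> V" using V_exists by blast
      show ?thesis
        using Y[of "k + v"] v k M'_subset_K K_closed(4) by (simp add: \<delta>_eq[OF v] qY add.assoc)
    qed
    then have "\<delta> Y' \<le> \<delta> (Y' + k)"
      using eqY[OF k] eqY[OF K_closed(1)] by simp
    also have "\<dots> \<le> q (Y' + k)"
      using \<delta>_le[OF M'_closed(1), of "Y' + k"] by simp
    finally show ?thesis by (simp add: qY')
  qed
  have "Y = Y'"
  proof (rule ccontr)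
    assume "Y \<noteq> Y'"
    then have z: "P (Y - Y') \<bullet> (Y - Y') > 0" using P_pos[of "Y - Y'"] by simp
    have "\<exists>k\<in>K. Q k (Y - Y') \<noteq> 0"
    proof (rule ccontr)
      assume non: "\<not> (\<exists>k\<in>K. Q k (Y - Y') \<noteq> 0)"
      have "m \<bullet> (Y - Y') = 0" if "m \<in> M" for m
        using P_surj[of m] that non by (auto simp: K_def Q_def)
      from full_lattice_orthogonal[OF M this] \<open>Y \<noteq> Y'\<close> show False by simp
    qed
    then have ne: "{k\<in>K. Q k (Y - Y') \<noteq> 0} \<noteq> {}" by blast
    have sub: "{k\<in>K. Q k (Y - Y') \<noteq> 0} \<subseteq> K" by blast
    obtain k where k: "k \<in> K" "Q k (Y - Y') \<noteq> 0"
      and kmin: "\<And>w. w \<in> K \<Longrightarrow> Q w (Y - Y') \<noteq> 0 \<Longrightarrow> q k \<le> q w"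
      using exists_nearest[OF sub ne, of 0] by (metis (mono_tags, lifting) add_0 mem_Collect_eq)
    \<comment> \<open>Otherwise \<open>w\<close> and \<open>w + k\<close> are both shorter than
      \<open>k\<close>, hence \<open>Q\<close>-orthogonal to \<open>Y - Y'\<close>, and so is their
      difference \<open>k\<close>.\<close>
    have min2: "0 \<le> q w + Q w k" if w: "w \<in> K" for w
    proof (rule ccontr)
      assume neg: "\<not> 0 \<le> q w + Q w k"
      have nn: "q w \<ge> 0" "q (w + k) \<ge> 0" by (rule q_nonneg)+
      have lt: "q (w + k) + q w < q k" using neg by (simp add: q_add Q_simps)
      have "Q w (Y - Y') = 0" using kmin[OF w] lt nn by force
      moreover have "Q (w + k) (Y - Y') = 0" using kmin[OF K_closed(4)[OF w k(1)]] lt nn by force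
      ultimately show False using k(2) by (simp add: Q_simps)
    qed
    have near: "\<delta> (Z + k) = q (Z + k)" if Z: "\<And>k. k \<in> K \<Longrightarrow> q Z \<le> q (Z + k)" for Z
    proof -
      have "Z + k \<in> V"
        unfolding V_iff
      proof
        fix v assume "v \<in> M'"
        then obtain w where w: "w \<in> K" "v = of_nat d *\<^sub>R w" using M'_d by blast
        have a: "0 \<le> q w + 2 * Q w Z" using Z[OF w(1)] by (simp add: q_add Q_sym)
        \<comment> \<open>Of the \<open>d\<close> copies of \<open>q w\<close>, one compensates
          \<open>2 * Q w Z\<close> and two compensate \<open>2 * Q w k\<close>. This is where
          \<open>d \<ge> 3\<close> enters.\<close>
        have "0 \<le> (real d - 3) * q w" "0 \<le> 2 * (q w + Q w k)"
          using d q_nonneg[of w] min2[OF w(1)] by simp_all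
        then have "0 \<le> (real d - 3) * q w + 2 * (q w + Q w k) + (q w + 2 * Q w Z)"
          by (rule add_nonneg_nonneg[OF add_nonneg_nonneg a])
        then have "0 \<le> real d * (real d * q w + 2 * Q w (Z + k))"
          by (intro mult_nonneg_nonneg) (simp_all add: Q_simps algebra_simps)
        then show "0 \<le> q v + 2 * Q v (Z + k)"
          by (simp add: w(2) q_scale Q_simps power2_eq_square algebra_simps)
      qed
      then show ?thesis using \<delta>_eq[OF M'_closed(1), of "Z + k"] by simp
    qed
    \<comment> \<open>The two sides differ by \<open>2 * Q k (Y - Y')\<close>, which is nonzero by
      the choice of \<open>k\<close>.\<close>
    have "q (Y + k) - q (Y' + k) = q Y - q Y'"
      using eqY[OF k(1)] eqY[OF K_closed(1)] near[OF Y] near[OF Y'] qY qY' by simp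
    then show False using k(2) by (simp add: q_add Q_simps Q_sym)
  qed
  then show ?thesis using u(1) by (simp add: Y_def Y'_def algebra_simps)
qed

text \<open>A closest point \<open>k\<close> of \<open>K\<close> to \<open>-y\<close> outside the generated coset is not in \<open>G\<close>. On the segment from it
  to the point \<open>k + d w\<close> of \<open>G\<close> in its class, \<open>k + w\<close> and \<open>k + 2 w\<close> are closer, and so \<open>w\<close> and \<open>k\<close>
  are generated.\<close>

lemma nearest_points_generate:
  assumes d: "d \<ge> (2::nat)" and M'_d: "\<And>u. u \<in> M' \<Longrightarrow> \<exists>w\<in>K. u = of_nat d *\<^sub>R w"
    and G: "\<And>k. k \<in> K \<Longrightarrow> \<exists>g\<in>G. g - k \<in> M' \<and> q (y + g) \<le> q (y + k)" and GK: "g0 \<in> G" "g0 \<in> K"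
    and S: "subgroup_set S" "\<And>g. g \<in> G \<Longrightarrow> g - g0 \<in> S"
  shows "K \<subseteq> S"
proof -
  have "{k\<in>K. k - g0 \<notin> S} = {}"
  proof (rule ccontr)
    assume ne: "{k\<in>K. k - g0 \<notin> S} \<noteq> {}"
    have sub: "{k\<in>K. k - g0 \<notin> S} \<subseteq> K" by blast
    obtain k where k: "k \<in> K" "k - g0 \<notin> S"
      and kmin: "\<And>w. w \<in> K \<Longrightarrow> w - g0 \<notin> S \<Longrightarrow> q (y + k) \<le> q (y + w)"
      using exists_nearest[OF sub ne, of y] by (metis (mono_tags, lifting) mem_Collect_eq)
    obtain g where g: "g \<in> G" "g - k \<in> M'" "q (y + g) \<le> q (y + k)" using G[OF k(1)] by blast
    obtain w where w: "w \<in> K" "g - k = of_nat d *\<^sub>R w" using M'_d[OF g(2)] by blast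
    have g_eq: "g = k + of_nat d *\<^sub>R w" using w(2) by (simp add: algebra_simps)
    have "w \<noteq> 0" using g_eq S(2)[OF g(1)] k(2) by auto
    have line: "q (y + (k + t *\<^sub>R w)) = q (y + k) + t\<^sup>2 * q w + 2 * t * Q w (y + k)" for t
      using q_add[of "y + k" "t *\<^sub>R w"] by (simp add: q_scale Q_simps Q_sym algebra_simps)
    have "real d * (real d * q w + 2 * Q w (y + k)) \<le> 0"
      using g(3) unfolding g_eq line by (simp add: power2_eq_square algebra_simps)
    \<comment> \<open>Along the line, the change of \<open>q\<close> is \<open>t\<close> times an
      increasing affine function of \<open>t\<close>. Being nonpositive at \<open>t = d\<close>,
      that function is negative for \<open>t < d\<close>.\<close>
    then have le: "real d * q w + 2 * Q w (y + k) \<le> 0"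
      using d by (simp add: mult_le_0_iff)
    have closer: "k + real j *\<^sub>R w - g0 \<in> S" if j: "0 < j" "j < d" for j
    proof -
      have "real j * (real j * q w + 2 * Q w (y + k)) < 0"
      proof (rule mult_pos_neg)
        have "real j * q w < real d * q w"
          using q_pos[OF \<open>w \<noteq> 0\<close>] j by (intro mult_strict_right_mono) auto
        then show "real j * q w + 2 * Q w (y + k) < 0" using le by simp
      qed (use j in simp)
      then have "q (y + (k + real j *\<^sub>R w)) < q (y + k)"
        unfolding line by (simp add: power2_eq_square algebra_simps)
      moreover have "k + real j *\<^sub>R w \<in> K"
        using subgroup_set_scale_int[OF K_subgroup w(1), of "int j"] k(1) K_closed(4) by simp
      ultimately show ?thesis using kmin by force
    qed
    have one: "k + w - g0 \<in> S" using closer[of 1] d by simp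
    \<comment> \<open>For \<open>d = 2\<close> this point is the end \<open>g\<close> of the
      segment, which is covered by the assumption on \<open>G\<close>.\<close>
    have two: "k + 2 *\<^sub>R w - g0 \<in> S"
      using closer[of 2] d S(2)[OF g(1)] g_eq by (cases "d = 2") auto
    have "w \<in> S" using subgroup_setD(2)[OF S(1) two one] by (simp add: algebra_simps scaleR_2)
    then show False using subgroup_setD(2)[OF S(1) one, of w] k(2) by (simp add: algebra_simps)
  qed
  \<comment> \<open>Applying the result to \<open>k + g0\<close> passes from the affine to the
    linear statement.\<close>
  then have "k \<in> S" if "k \<in> K" for k
    using K_closed(4)[OF that GK(2)] by force
  then show ?thesis by blast
qed

end

context polarized
begin

subsection \<open>The common refinement of the linearity domains\<close>

text \<open>\<open>k \<in> near x\<close> means that \<open>-k\<close> is closest to \<open>x + c\<close> in its class modulo \<open>M'\<close>.\<close>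

definition near :: "'a \<Rightarrow> 'a set" where "near x = {k\<in>K. x + c + k \<in> V}"

text \<open>The smallest closed cell that contains \<open>x\<close>. The inclusion is not an
  equality because further vectors become nearest on the boundary.\<close>

definition cell :: "'a \<Rightarrow> 'a set" where "cell x = {z. near x \<subseteq> near z}"

lemma near_exists:
  assumes "k \<in> K" obtains k' where "k' \<in> near x" "k' - k \<in> M'"
proof -
  obtain u where u: "u \<in> M'" "x + c + k + u \<in> V" using V_exists by blast
  show ?thesis
    using u assms M'_subset_K K_closed(4) by (intro that[of "k + u"]) (auto simp: near_def add.assoc)
qed

text \<open>For \<open>z\<close> in the ball, \<open>q\<close> is bounded at \<open>z + c\<close>
  and, by \<open>V_bounded\<close>, at \<open>z + c + k\<close>; hence it is bounded at their
  difference \<open>k\<close>.\<close>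

lemma near_locally_finite: "finite (\<Union>z\<in>ball x 1. near z)"
proof -
  obtain R where R: "\<And>y. y \<in> V \<Longrightarrow> q y \<le> R" using V_bounded by blast
  obtain C where C: "\<And>x r. norm x \<le> r \<Longrightarrow> q x \<le> C * r\<^sup>2" using q_bound by blast
  have "q k \<le> 2 * R + 2 * (C * (norm x + 1 + norm c)\<^sup>2)" if "z \<in> ball x 1" "k \<in> near z" for z k
  proof -
    have "norm (z + c) \<le> norm x + 1 + norm c"
      using that(1) norm_triangle_ineq[of z c] norm_triangle_ineq2[of z x]
      by (simp add: dist_norm norm_minus_commute)
    then have "q (z + c) \<le> C * (norm x + 1 + norm c)\<^sup>2" by (rule C)
    moreover have "q (z + c + k) \<le> R" using that(2) R by (simp add: near_def)
    moreover have "q k \<le> 2 * q (z + c + k) + 2 * q (z + c)"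
      using q_nonneg[of "z + c + k + (z + c)"] q_add[of "z + c + k" "z + c"]
        q_diff[of "z + c + k" "z + c"] by simp
    ultimately show ?thesis by linarith
  qed
  then show ?thesis
    by (intro finite_subset[OF _ finite_q_le[of "2 * R + 2 * (C * (norm x + 1 + norm c)\<^sup>2)"]])
      (auto simp: near_def)
qed

lemma near_same_q:
  assumes "k \<in> near y" "k' \<in> near y" "k' - k \<in> M'"
  shows "q (y + c + k') = q (y + c + k)"
  using V_translate[of "y + c + k" "y + c + k'"] V_translate[of "y + c + k'" "y + c + k"]
    M'_closed(3)[OF assms(3)] assms by (simp add: near_def)

lemma near_of_same_q:
  assumes "k' \<in> near y" "k \<in> K" "k' - k \<in> M'" "q (y + c + k) = q (y + c + k')"
  shows "k \<in> near y"
  using V_same_q[of "y + c + k'" "y + c + k"] M'_closed(3)[OF assms(3)] assms by (simp add: near_def)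

text \<open>The terms quadratic in \<open>y\<close> cancel, so the gap between two competitors is
  affine in \<open>y\<close>.\<close>

lemma q_gap: "q (y + c + k) - q (y + c + k') = q k - q k' + 2 * Q (k - k') c + 2 * Q (k - k') y"
  by (simp add: q_add Q_simps Q_sym[of _ k] Q_sym[of _ k'])

text \<open>The gap between \<open>k\<close> and \<open>k'\<close> is affine, nonnegative at both
  ends and zero at the inner point \<open>z\<close>; so it vanishes at \<open>a\<close>.\<close>

lemma near_open_segment:
  assumes a: "k' \<in> near a" and b: "k' \<in> near b" and k: "k \<in> near z" and z: "z \<in> open_segment a b"
    and k'z: "k' \<in> near z" and kk': "k' - k \<in> M'"
  shows "k \<in> near a"
proof -
  define D where "D y = q (y + c + k) - q (y + c + k')" for y
  obtain t where t: "0 < t" "t < 1" "z = (1 - t) *\<^sub>R a + t *\<^sub>R b"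
    using z by (auto simp: in_segment)
  have nonneg: "D y \<ge> 0" if "k' \<in> near y" for y
    using V_translate[of "y + c + k'" "y + c + k"] M'_closed(3)[OF kk'] that
    by (simp add: D_def near_def)
  have "D z = (1 - t) * D a + t * D b"
    unfolding D_def q_gap t(3) by (simp add: Q_simps algebra_simps)
  moreover have "D z = 0" using near_same_q[OF k k'z kk'] by (simp add: D_def)
  moreover have "(1 - t) * D a \<ge> 0" "t * D b \<ge> 0" using nonneg a b t by auto
  ultimately have "(1 - t) * D a = 0" by linarith
  then have "D a = 0" using t by simp
  then show ?thesis using near_of_same_q[OF a _ kk'] k by (simp add: D_def near_def)
qed

lemma convex_cell: "convex (cell x)"
proof (rule convexI)
  fix a b and s t :: real
  assume ab: "a \<in> cell x" "b \<in> cell x" and st: "0 \<le> s" "0 \<le> t" "s + t = 1"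
  have "s *\<^sub>R a + t *\<^sub>R b + c + k \<in> V" if "k \<in> near x" for k
  proof -
    have "s *\<^sub>R (a + c + k) + t *\<^sub>R (b + c + k) \<in> V"
      using ab st that by (intro V_convex_combination) (auto simp: cell_def near_def)
    also have "s *\<^sub>R (a + c + k) + t *\<^sub>R (b + c + k) = s *\<^sub>R a + t *\<^sub>R b + (s + t) *\<^sub>R (c + k)"
      by (simp add: algebra_simps)
    finally show ?thesis using st by (simp add: add.assoc)
  qed
  then show "s *\<^sub>R a + t *\<^sub>R b \<in> cell x" by (auto simp: cell_def near_def)
qed

lemma cell_Int_face: "cell x \<inter> cell y face_of cell x"
proof -
  have "a \<in> cell y"
    if ab: "a \<in> cell x" "b \<in> cell x" and z: "z \<in> cell x" "z \<in> cell y" "z \<in> open_segment a b" for a b z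
  proof -
    have "k \<in> near a" if k: "k \<in> near y" for k
    proof -
      have "k \<in> K" using k by (simp add: near_def)
      \<comment> \<open>The rival is taken from \<open>near x\<close>, so that it is nearest in its
        class at every point of \<open>cell x\<close>.\<close>
      then obtain k' where "k' \<in> near x" "k' - k \<in> M'" using near_exists by blast
      then show ?thesis
        using near_open_segment[of k' a b k z] ab z k by (auto simp: cell_def)
    qed
    then show ?thesis by (auto simp: cell_def)
  qed
  note left = this
  show ?thesis
    unfolding face_of_def
  proof (intro conjI ballI impI)
    fix a b z
    assume *: "a \<in> cell x" "b \<in> cell x" "z \<in> cell x \<inter> cell y" "z \<in> open_segment a b"
    then show "a \<in> cell x \<inter> cell y" using left[of a b z] by blast
    show "b \<in> cell x \<inter> cell y" using left[of b a z] * open_segment_commute[of a b] by blast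
  qed (simp_all add: convex_Int convex_cell)
qed

text \<open>This replaces the statement that \<open>y\<close> is in the relative interior of \<open>cell y\<close>: close to \<open>y\<close>, only the
  elements of \<open>near y\<close> compete.\<close>

lemma cell_prolong:
  assumes z: "z \<in> cell y" "z \<noteq> y"
  obtains y' where "y' \<in> cell y" "y \<in> open_segment z y'"
proof -
  \<comment> \<open>\<open>?G\<close> holds the finitely many vectors that are nearest somewhere
    close to \<open>y\<close> but not at \<open>y\<close>. The set \<open>?W\<close> where one of
    them is nearest is closed and misses \<open>y\<close>.\<close>
  let ?G = "(\<Union>z\<in>ball y 1. near z) - near y"
  let ?W = "\<Union>k\<in>?G. (\<lambda>z. z + c + k) -` V"
  have "closed ?W"
    using near_locally_finite
    by (intro closed_UN finite_Diff continuous_closed_vimage V_closed ballI) (auto intro!: continuous_intros)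
  then have "open (ball y 1 - ?W)" by (intro open_Diff) auto
  moreover have "y \<in> ball y 1 - ?W" by (auto simp: near_def)
  ultimately obtain \<epsilon> where \<epsilon>: "\<epsilon> > 0" "ball y \<epsilon> \<subseteq> ball y 1 - ?W"
    using openE by blast
  \<comment> \<open>This puts \<open>y'\<close> at distance \<open>\<epsilon> / 2\<close> from
    \<open>y\<close>.\<close>
  define t where "t = \<epsilon> / (2 * norm (y - z))"
  have t: "t > 0" using \<epsilon> z by (simp add: t_def)
  define y' where "y' = y + t *\<^sub>R (y - z)"
  have "y' \<in> ball y \<epsilon>"
    using z(2) \<epsilon>(1) by (simp add: y'_def dist_norm t_def)
  then have "y' \<in> ball y 1 - ?W" using \<epsilon>(2) by blast
  then have sub: "near y' \<subseteq> near y" unfolding near_def by blast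
  have "k \<in> near y'" if k: "k \<in> near y" for k
  proof -
    have kK: "k \<in> K" using k by (simp add: near_def)
    \<comment> \<open>The rival \<open>k'\<close> is tied with \<open>k\<close> at \<open>y\<close>
      and at \<open>z\<close>. Since the gap is affine, the tie extends along the line to
      \<open>y'\<close>.\<close>
    then obtain k' where k': "k' \<in> near y'" "k' - k \<in> M'" using near_exists by blast
    define D where "D x = q (x + c + k) - q (x + c + k')" for x
    have "D y = 0" using near_same_q[OF k _ k'(2)] sub k'(1) by (auto simp: D_def)
    moreover have "D z = 0"
      using near_same_q[OF _ _ k'(2), of z] sub k k'(1) z(1) unfolding D_def cell_def by force
    moreover have "D y' = (1 + t) * D y - t * D z"
      unfolding D_def q_gap y'_def by (simp add: Q_simps algebra_simps)
    ultimately show ?thesis using near_of_same_q[OF k'(1) kK k'(2)] by (simp add: D_def)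
  qed
  then have 1: "y' \<in> cell y" by (auto simp: cell_def)
  have "y = (1 - 1 / (1 + t)) *\<^sub>R z + (1 / (1 + t)) *\<^sub>R y'"
  proof -
    have "(1 + t) *\<^sub>R ((1 - 1 / (1 + t)) *\<^sub>R z + (1 / (1 + t)) *\<^sub>R y') = t *\<^sub>R z + y'"
      using t by (simp add: scaleR_add_right right_diff_distrib)
    also have "\<dots> = (1 + t) *\<^sub>R y" by (simp add: y'_def algebra_simps)
    finally show ?thesis using t by simp
  qed
  moreover have "z \<noteq> y'"
  proof
    assume "z = y'"
    then have "(1 + t) *\<^sub>R (y - z) = 0" by (simp add: y'_def algebra_simps)
    then show False using t z(2) by simp
  qed
  moreover have "0 < 1 / (1 + t)" "1 / (1 + t) < 1" using t by auto
  ultimately have 2: "y \<in> open_segment z y'" unfolding in_segment by blast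
  show ?thesis by (rule that[OF 1 2])
qed

text \<open>For \<open>y\<close> in the relative interior of \<open>F\<close>, the face
  \<open>cell y\<close> of \<open>cell x\<close> contains \<open>F\<close>. Conversely,
  \<open>cell_prolong\<close> puts \<open>y\<close> inside a segment starting at any other
  \<open>z\<close> in \<open>cell y\<close>, which forces \<open>z\<close> into
  \<open>F\<close>.\<close>

lemma face_of_cell:
  assumes F: "F face_of cell x" "F \<noteq> {}"
  obtains y where "F = cell y"
proof -
  have "rel_interior F \<noteq> {}"
    using F face_of_imp_convex rel_interior_eq_empty by blast
  then obtain y where y: "y \<in> rel_interior F" by blast
  then have yF: "y \<in> F" using rel_interior_subset by blast
  have Fsub: "F \<subseteq> cell x" by (rule face_of_imp_subset[OF F(1)])
  then have "cell y \<subseteq> cell x" using yF by (auto simp: cell_def)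
  moreover from this have face: "cell y face_of cell x"
    using cell_Int_face[of x y] by (simp add: Int_absorb1)
  moreover have "y \<in> cell y" by (simp add: cell_def)
  ultimately have "F \<subseteq> cell y"
    using subset_of_face_of[OF face Fsub] y by blast
  moreover have "z \<in> F" if z: "z \<in> cell y" for z
  proof (cases "z = y")
    case False
    obtain y' where "y' \<in> cell y" "y \<in> open_segment z y'"
      using cell_prolong[OF z False] by blast
    then show ?thesis
      using face_ofD[OF F(1), of y z y'] yF z \<open>cell y \<subseteq> cell x\<close> by blast
  qed (use yF in simp)
  ultimately show ?thesis using that[of y] by blast
qed

text \<open>The cell is a finite intersection of translates of the polytope \<open>V\<close>, whose
  facet normals \<open>P v\<close> lie in \<open>M\<close>.\<close>

lemma rational_polyhedron_cell: "rational_polyhedron M (cell x)"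
proof -
  obtain F where F: "finite F" "F \<subseteq> M'" "\<And>y. y \<in> V \<longleftrightarrow> (\<forall>v\<in>F. 0 \<le> q v + 2 * Q v y)"
    by (rule V_finite) (rule that)
  define A where "A = (\<lambda>(k, v). (P v, - q v / 2 - Q v (c + k))) ` (near x \<times> F)"
  have "near x \<subseteq> (\<Union>z\<in>ball x 1. near z)" by force
  then have "finite (near x)" using near_locally_finite finite_subset by blast
  then have "finite A" using F(1) by (simp add: A_def)
  moreover have "A \<subseteq> M \<times> UNIV" using F(2) P_M' by (auto simp: A_def)
  moreover have "cell x = {z. \<forall>(u, b)\<in>A. u \<bullet> z \<ge> b}"
  proof -
    have "z \<in> cell x \<longleftrightarrow> (\<forall>k\<in>near x. z + c + k \<in> V)" for z
      by (auto simp: cell_def near_def)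
    moreover have "0 \<le> q v + 2 * Q v (z + c + k) \<longleftrightarrow> P v \<bullet> z \<ge> - q v / 2 - Q v (c + k)" for z v k
      by (auto simp: Q_simps Q_def[of v z])
    ultimately show ?thesis by (auto simp: A_def F(3))
  qed
  ultimately show ?thesis unfolding rational_polyhedron_def by blast
qed

lemma cell_decomposition: "rational_polyhedral_decomposition M (range cell)"
  unfolding rational_polyhedral_decomposition_def
proof (intro conjI ballI allI impI)
  have self: "x \<in> cell x" for x by (simp add: cell_def)
  fix A assume "A \<in> range cell"
  then obtain x where A: "A = cell x" by blast
  show "rational_polyhedron M A" by (simp add: A rational_polyhedron_cell)
  show "A \<noteq> {}" using self A by blast
  show "F \<in> range cell" if "F face_of A \<and> F \<noteq> {}" for F
    using that face_of_cell[of F x] A by blast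
  fix B assume "B \<in> range cell"
  then obtain y where B: "B = cell y" by blast
  show "A \<inter> B face_of A" "A \<inter> B face_of B"
    using cell_Int_face[of x y] cell_Int_face[of y x] by (simp_all add: A B Int_commute)
next
  show "\<Union> (range cell) = UNIV" by (auto simp: cell_def)
  show "locally_finite_in euclidean (range cell)"
    unfolding locally_finite_in_def
  proof (intro conjI ballI)
    fix x :: 'a
    let ?G = "\<Union>z\<in>ball x 1. near z"
    \<comment> \<open>A cell that meets the ball is determined by \<open>near y\<close>, a subset of
      the finite set \<open>?G\<close>.\<close>
    have "{A \<in> range cell. A \<inter> ball x 1 \<noteq> {}} \<subseteq> (\<lambda>N. {z. N \<subseteq> near z}) ` Pow ?G"
    proof
      fix A assume "A \<in> {A \<in> range cell. A \<inter> ball x 1 \<noteq> {}}"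
      then obtain y z where "A = cell y" "z \<in> cell y" "z \<in> ball x 1" by blast
      then show "A \<in> (\<lambda>N. {z. N \<subseteq> near z}) ` Pow ?G"
        by (intro image_eqI[of _ _ "near y"]) (auto simp: cell_def)
    qed
    then have "finite {A \<in> range cell. A \<inter> ball x 1 \<noteq> {}}"
      by (rule finite_subset) (intro finite_imageI finite_Pow_iff[THEN iffD2] near_locally_finite)
    then show "\<exists>U. openin euclidean U \<and> x \<in> U \<and> finite {A \<in> range cell. A \<inter> U \<noteq> {}}"
      by (intro exI[of _ "ball x 1"]) auto
  qed auto
qed

end

subsection \<open>Theta functions\<close>

lemma torus_proj_eq:
  assumes "subgroup_set M'" "x - x' \<in> M'"
  shows "torus_proj M' x = torus_proj M' x'"
proof -
  have "torus_proj M' y \<subseteq> torus_proj M' y'" if "y - y' \<in> M'" for y y'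
  proof -
    have "y + u = y' + (y - y' + u)" "y - y' + u \<in> M'" if "u \<in> M'" for u
      using subgroup_setD(4)[OF assms(1) \<open>y - y' \<in> M'\<close> that] by simp_all
    then show ?thesis unfolding torus_proj_def by blast
  qed
  from this[of x x'] this[of x' x] show ?thesis
    using assms(2) subgroup_setD(3)[OF assms] by auto
qed

text \<open>Duality: if the \<open>m j\<close> generate \<open>M\<close>, pairing with them
  separates points, and a point that pairs integrally with all of them lies in the dual lattice. The
  latter makes the cokernel torsion-free.\<close>

lemma unimodular_linearI:
  assumes M: "full_lattice M" and m: "\<And>j. j < N \<Longrightarrow> m j \<in> M"
    and gen: "\<And>S. subgroup_set S \<Longrightarrow> (\<And>j. j < N \<Longrightarrow> m j \<in> S) \<Longrightarrow> M \<subseteq> S"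
  shows "unimodular_linear M N (\<lambda>x j. if j < N then m j \<bullet> x else 0)" (is "unimodular_linear M N ?A")
  unfolding unimodular_linear_def
proof (intro conjI allI ballI impI)
  show "linear (\<lambda>x. ?A x i)" for i
    by (auto intro!: linearI simp: inner_add_right)
  show "?A ` dual_lattice M \<subseteq> int_points N"
    using m by (auto simp: dual_lattice_def int_points_def topspace_Euclidean_space)
  show "inj_on ?A (dual_lattice M)"
  proof (rule inj_onI)
    fix x y assume eq: "?A x = ?A y"
    have "m j \<bullet> (x - y) = 0" if "j < N" for j
      using fun_cong[OF eq, of j] that by (simp add: inner_diff_right)
    then have "M \<subseteq> {u. u \<bullet> (x - y) = 0}"
      by (intro gen) (auto simp: subgroup_set_def inner_diff_left)
    then have "x - y = 0" by (intro full_lattice_orthogonal[OF M]) auto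
    then show "x = y" by simp
  qed
  fix v k assume v: "v \<in> int_points N" and k: "k \<noteq> 0 \<and> (\<lambda>i. of_int k * v i) \<in> ?A ` dual_lattice M"
  then obtain x where x: "(\<lambda>i. of_int k * v i) = ?A x" by blast
  define y where "y = (1 / of_int k) *\<^sub>R x"
  have v_eq: "v = ?A y"
  proof
    fix i
    have "of_int k * v i = ?A x i" by (rule fun_cong[OF x])
    then show "v i = ?A y i" using k by (auto simp: y_def field_simps split: if_splits)
  qed
  have "m j \<bullet> y \<in> \<int>" if "j < N" for j
  proof -
    have "v j \<in> \<int>" using v by (simp add: int_points_def)
    then show ?thesis using that fun_cong[OF v_eq, of j] by simp
  qed
  then have "M \<subseteq> {u. u \<bullet> y \<in> \<int>}"
    by (intro gen) (auto simp: subgroup_set_def inner_diff_left)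
  then have "y \<in> dual_lattice M" by (auto simp: dual_lattice_def)
  then show "v \<in> ?A ` dual_lattice M" using v_eq by blast
qed

text \<open>The data in geometric form: \<open>\<gamma>\<close> is split into its quadratic and
  linear parts, and the type enters as the divisibility of \<open>M'\<close> by \<open>d\<close> in
  \<open>K\<close>.\<close>

locale polarized_theta = polarized +
  fixes lam :: "'a \<Rightarrow> 'a" and \<gamma> :: "'a \<Rightarrow> real" and b :: "nat \<Rightarrow> 'a" and D d :: nat
  assumes lam: "u \<in> M' \<Longrightarrow> lam u = P u"
    and \<gamma>: "u \<in> M' \<Longrightarrow> \<gamma> u = q u / 2 + Q c u"
    and b: "coset_representatives M M' lam D b"
    and M'_d: "u \<in> M' \<Longrightarrow> \<exists>w\<in>K. u = of_nat d *\<^sub>R w"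
begin

definition th :: "nat \<Rightarrow> 'a \<Rightarrow> real" where "th i = theta M' lam \<gamma> (b i)"

definition branch :: "nat \<Rightarrow> 'a \<Rightarrow> 'a \<Rightarrow> real" where
  "branch i u x = (b i + lam u) \<bullet> x + \<gamma> u + b i \<bullet> u"

definition \<beta> :: "nat \<Rightarrow> 'a" where "\<beta> i = inv P (b i)"

lemma P_\<beta>: "P (\<beta> i) = b i"
  unfolding \<beta>_def using P_surj[of "b i"] by (metis f_inv_into_f rangeI)

lemma \<beta>_K: "i \<in> {1..D} \<Longrightarrow> \<beta> i \<in> K"
  using b by (auto simp: K_def P_\<beta> coset_representatives_def)

lemma \<beta>_class:
  assumes "k \<in> K" obtains i where "i \<in> {1..D}" "k - \<beta> i \<in> M'"
proof -
  obtain i u where i: "i \<in> {1..D}" "u \<in> M'" "P k - b i = lam u"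
    using b assms unfolding coset_representatives_def K_def by blast
  then have "P (k - \<beta> i) = P u" by (simp add: linear_diff[OF P] P_\<beta> lam)
  then have "k - \<beta> i = u" using P_inj by (simp add: inj_eq)
  then show ?thesis using that i by blast
qed

lemma D_pos: "1 \<in> {1..D}"
  using \<beta>_class[OF K_closed(1)] by force

text \<open>Completing the square. The subtracted term is independent of \<open>u\<close>, so
  minimizing over \<open>u\<close> is a nearest-point problem.\<close>

lemma branch_eq:
  "u \<in> M' \<Longrightarrow> branch i u x = q (x + c + \<beta> i + u) / 2 - (q (x + c) + q (\<beta> i) + 2 * Q (\<beta> i) c) / 2"
  by (simp add: branch_def lam \<gamma> P_\<beta>[symmetric] q_add Q_simps inner_add_left Q_def[symmetric]
      Q_sym[of x u] Q_sym[of x "\<beta> i"] Q_sym[of c "\<beta> i"] Q_sym[of u "\<beta> i"] field_simps)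

lemma th_eq_branch:
  assumes "u \<in> M'" "x + c + \<beta> i + u \<in> V"
  shows "th i x = branch i u x"
  unfolding th_def theta_def branch_def[symmetric]
proof (rule Least_equality)
  show "\<exists>v\<in>M'. branch i u x = branch i v x" using assms(1) by blast
  show "branch i u x \<le> t" if t: "\<exists>v\<in>M'. t = branch i v x" for t
  proof -
    obtain v where v: "v \<in> M'" "t = branch i v x" using t by blast
    have "q (x + c + \<beta> i + u) \<le> q (x + c + \<beta> i + v)"
      using V_translate[OF assms(2), of "x + c + \<beta> i + v"] M'_closed(2)[OF v(1) assms(1)] by simp
    then show ?thesis using v assms(1) by (simp add: branch_eq)
  qed
qed

lemma th_\<delta>: "th i x = \<delta> (x + c + \<beta> i) / 2 - (q (x + c) + q (\<beta> i) + 2 * Q (\<beta> i) c) / 2"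
proof -
  obtain u where "u \<in> M'" "x + c + \<beta> i + u \<in> V" using V_exists by blast
  then show ?thesis by (simp add: th_eq_branch branch_eq \<delta>_eq)
qed

lemma th_le_branch: "u \<in> M' \<Longrightarrow> th i x \<le> branch i u x"
  using \<delta>_le[of u "x + c + \<beta> i"] by (simp add: th_\<delta> branch_eq)

text \<open>The branch that is minimal at an intermediate point bounds \<open>th i\<close> from
  above at both ends. So \<open>th i\<close> is concave on the whole space, hence
  continuous.\<close>

lemma continuous_on_th: "continuous_on UNIV (th i)"
proof -
  have "convex_on UNIV (\<lambda>x. - th i x)"
  proof (rule convex_onI)
    fix t :: real and x y :: 'a
    assume t: "0 < t" "t < 1"
    obtain u where u: "u \<in> M'" "(1 - t) *\<^sub>R x + t *\<^sub>R y + c + \<beta> i + u \<in> V"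
      using V_exists by blast
    have "th i ((1 - t) *\<^sub>R x + t *\<^sub>R y) = (1 - t) * branch i u x + t * branch i u y"
      unfolding th_eq_branch[OF u] branch_def
      by (simp add: inner_add_left inner_add_right algebra_simps)
    moreover have "(1 - t) * th i x \<le> (1 - t) * branch i u x" "t * th i y \<le> t * branch i u y"
      using t th_le_branch[OF u(1)] by (auto intro: mult_left_mono)
    ultimately show "- th i ((1 - t) *\<^sub>R x + t *\<^sub>R y) \<le> (1 - t) * - th i x + t * - th i y"
      by simp
  qed simp
  then have "continuous_on UNIV (\<lambda>x. - th i x)" by (rule convex_on_continuous[OF open_UNIV])
  then have "continuous_on UNIV (\<lambda>x. - (- th i x))" by (rule continuous_on_minus)
  then show ?thesis by simp
qed

section \<open>The map to tropical projective space\<close>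

abbreviation \<phi> :: "'a set \<Rightarrow> nat \<Rightarrow> real" where "\<phi> \<equiv> theta_map M' lam \<gamma> D b"

text \<open>Differences of theta functions are periodic by \<open>th_\<delta>\<close>, so all lifts
  give one point and \<open>the_elem\<close> is applied to a singleton.\<close>

lemma theta_map_eq: "\<phi> (torus_proj M' x) = tropical_point D (\<lambda>i. th i x)"
proof -
  have "th i (x + u) - th j (x + u) = th i x - th j x" if "u \<in> M'" for u i j
  proof -
    have "\<delta> (x + u + c + \<beta> i) = \<delta> (x + c + \<beta> i)" for i
      using \<delta>_periodic[OF that, of "x + c + \<beta> i"] by (simp add: algebra_simps)
    then show ?thesis by (simp add: th_\<delta> field_simps)
  qed
  then have "tropical_point D (\<lambda>i. th i (x + u)) = tropical_point D (\<lambda>i. th i x)" if "u \<in> M'" for u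
    using that by (auto simp: tropical_point_def)
  then have "(\<lambda>x. tropical_point D (\<lambda>i. th i x)) ` torus_proj M' x = {tropical_point D (\<lambda>i. th i x)}"
    using M'_closed(1) unfolding torus_proj_def by force
  then show ?thesis by (simp add: theta_map_def th_def[symmetric])
qed

lemma continuous_map_theta_map: "continuous_map (torus M') (Euclidean_space (D - 1)) \<phi>"
proof (rule continuous_compose_quotient_map[OF quotient_map_torus_proj])
  have "continuous_map euclidean euclideanreal (\<lambda>x. tropical_point D (\<lambda>i. th i x) j)" for j
    by (auto simp: tropical_point_def intro!: continuous_on_diff continuous_on_th)
  then show "continuous_map euclidean (Euclidean_space (D - 1)) (\<phi> \<circ> torus_proj M')"
    unfolding Euclidean_space_def continuous_map_in_subtopology continuous_map_componentwise_UNIV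
    by (auto simp: theta_map_eq tropical_point_def)
qed

lemma compact_space_torus: "compact_space (torus M')"
proof -
  obtain R where R: "\<And>x. \<exists>u\<in>M'. norm (x + u) \<le> R"
    using full_lattice_covering[OF M'] by blast
  have "torus_proj M' x \<in> torus_proj M' ` cball 0 R" for x
  proof -
    obtain u where u: "u \<in> M'" "norm (x + u) \<le> R" using R by blast
    have "torus_proj M' x = torus_proj M' (x + u)"
      using torus_proj_eq[OF M'_subgroup, of "x + u" x] u(1) by simp
    then show ?thesis using u(2) by auto
  qed
  then have "topspace (torus M') = torus_proj M' ` cball 0 R"
    unfolding topspace_torus by blast
  moreover have "compactin (torus M') (torus_proj M' ` cball 0 R)"
    by (rule image_compactin[OF _ quotient_imp_continuous_map[OF quotient_map_torus_proj]]) simp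
  ultimately show ?thesis by (simp add: compact_space_def)
qed

lemma inj_on_theta_map:
  assumes d: "d \<ge> 3"
  shows "inj_on \<phi> (topspace (torus M'))"
proof (rule inj_onI)
  fix X X' assume "X \<in> topspace (torus M')" "X' \<in> topspace (torus M')" and eq: "\<phi> X = \<phi> X'"
  then obtain x x' where X: "X = torus_proj M' x" "X' = torus_proj M' x'"
    unfolding topspace_torus by blast
  have th: "th i x - th 1 x = th i x' - th 1 x'" if i: "i \<in> {1..D}" for i
  proof (cases "i = 1")
    case False
    \<comment> \<open>Coordinate \<open>j\<close> of \<open>tropical_point\<close> compares the
      functions with indices \<open>j + 2\<close> and 1.\<close>
    then have "i - 2 < D - 1" "i - 2 + 2 = i" using i by auto
    then show ?thesis
      using fun_cong[OF eq, of "i - 2"] by (simp add: X theta_map_eq tropical_point_def)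
  qed simp
  \<comment> \<open>In differences of \<open>th_\<delta>\<close> between \<open>x\<close> and
    \<open>x'\<close>, all corrections are common to every \<open>i\<close>. So equal images make
    the differences of \<open>\<delta>\<close> one constant, as \<open>\<delta>_injective\<close>
    requires.\<close>
  define \<kappa> where "\<kappa> = \<delta> (x + c + \<beta> 1) - \<delta> (x' + c + \<beta> 1)"
  have "\<delta> (x + c + k) - \<delta> (x' + c + k) = \<kappa>" if k: "k \<in> K" for k
  proof -
    obtain i where i: "i \<in> {1..D}" "k - \<beta> i \<in> M'" using \<beta>_class[OF k] by blast
    have eq: "\<delta> (y + c + k) = \<delta> (y + c + \<beta> i)" for y
      using \<delta>_periodic[OF i(2), of "y + c + \<beta> i"] by simp
    show ?thesis
      using th[OF i(1)] unfolding eq \<kappa>_def th_\<delta> by (simp add: diff_divide_distrib add_divide_distrib)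
  qed
  from \<delta>_injective[OF d M'_d this] show "X = X'"
    unfolding X by (intro torus_proj_eq[OF M'_subgroup]) simp
qed

text \<open>A continuous injection from a compact space to a Hausdorff space is closed onto its
  image.\<close>

lemma embedding_map_theta_map:
  assumes "d \<ge> 3"
  shows "embedding_map (torus M') (Euclidean_space (D - 1)) \<phi>"
proof (rule injective_closed_imp_embedding_map[OF continuous_map_theta_map _ inj_on_theta_map[OF assms]])
  have "Hausdorff_space (Euclidean_space (D - 1))"
    unfolding Euclidean_space_def
    by (intro Hausdorff_space_subtopology) (simp add: Hausdorff_space_product_topology)
  then show "closed_map (torus M') (Euclidean_space (D - 1)) \<phi>"
    by (rule continuous_imp_closed_map[OF continuous_map_theta_map compact_space_torus])
qed

text \<open>Branches minimal at \<open>x\<close> stay minimal on \<open>cell x\<close>, so the map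
  is affine there. Its slopes come from the points \<open>k i\<close> nearest to
  \<open>- (x + c)\<close> in their classes, and \<open>nearest_points_generate\<close> supplies the
  generation that \<open>unimodular_linearI\<close> asks for.\<close>

lemma unimodular_theta_map:
  assumes d: "d \<ge> 2"
  shows "unimodular M M' (D - 1) \<phi>"
  unfolding unimodular_def
proof (intro exI[of _ "range cell"] conjI ballI cell_decomposition)
  fix C assume "C \<in> range cell"
  then obtain x where C: "C = cell x" by blast
  have "\<exists>u. u \<in> M' \<and> x + c + \<beta> i + u \<in> V" for i
    using V_exists[of "x + c + \<beta> i"] by blast
  then obtain u where u: "\<And>i. u i \<in> M'" "\<And>i. x + c + \<beta> i + u i \<in> V" by metis
  define k where "k i = \<beta> i + u i" for i
  have kK: "k i \<in> K" if "i \<in> {1..D}" for i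
    using \<beta>_K[OF that] u(1) M'_subset_K K_closed(4) by (simp add: k_def)
  have Pk: "P (k i) = b i + lam (u i)" for i
    by (simp add: k_def linear_add[OF P] P_\<beta> lam u)
  have th: "th i z = P (k i) \<bullet> z + \<gamma> (u i) + b i \<bullet> u i" if "i \<in> {1..D}" "z \<in> cell x" for i z
  proof -
    have "k i \<in> near x" using kK[OF that(1)] u(2)[of i] by (simp add: near_def k_def add.assoc)
    then have "z + c + \<beta> i + u i \<in> V" using that(2) by (auto simp: cell_def near_def k_def add.assoc)
    then show ?thesis by (simp add: th_eq_branch[OF u(1)] branch_def Pk)
  qed
  let ?m = "\<lambda>j. P (k (j + 2)) - P (k 1)"
  let ?A = "\<lambda>x j. if j < D - 1 then ?m j \<bullet> x else 0"
  let ?a = "\<lambda>j. if j < D - 1 then \<gamma> (u (j + 2)) + b (j + 2) \<bullet> u (j + 2) - \<gamma> (u 1) - b 1 \<bullet> u 1 else 0"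
  have "unimodular_linear M (D - 1) ?A"
  proof (rule unimodular_linearI[OF M])
    show "?m j \<in> M" if "j < D - 1" for j
      using kK[of "j + 2"] kK[of 1] D_pos that subgroup_setD(2)[OF full_lattice_subgroup[OF M]]
      by (simp add: K_def)
    fix S assume S: "subgroup_set S" "\<And>j. j < D - 1 \<Longrightarrow> ?m j \<in> S"
    have "K \<subseteq> P -` S"
    proof (rule nearest_points_generate[OF d M'_d, where G = "k ` {1..D}" and y = "x + c" and ?g0.0 = "k 1"])
      show "subgroup_set (P -` S)"
        using S(1) by (auto simp: subgroup_set_def linear_0[OF P] linear_diff[OF P])
      show "k 1 \<in> k ` {1..D}" "k 1 \<in> K" using D_pos kK by blast+
      show "g - k 1 \<in> P -` S" if "g \<in> k ` {1..D}" for g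
      proof -
        obtain i where i: "g = k i" "i \<in> {1..D}" using \<open>g \<in> k ` {1..D}\<close> by blast
        show ?thesis
        proof (cases "i = 1")
          case False
          then have "i - 2 < D - 1" "i - 2 + 2 = i" using i by auto
          then show ?thesis using S(2)[of "i - 2"] by (simp add: i linear_diff[OF P])
        qed (use subgroup_setD(1)[OF S(1)] in \<open>simp add: i linear_0[OF P]\<close>)
      qed
      show "\<exists>g\<in>k ` {1..D}. g - l \<in> M' \<and> q (x + c + g) \<le> q (x + c + l)" if l: "l \<in> K" for l
      proof -
        obtain i where i: "i \<in> {1..D}" "l - \<beta> i \<in> M'" using \<beta>_class[OF l] by blast
        have "k i - l = u i - (l - \<beta> i)" by (simp add: k_def)
        then have "k i - l \<in> M'" using M'_closed(2)[OF u(1)[of i] i(2)] by (simp only:)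
        moreover have "q (x + c + k i) \<le> q (x + c + l)"
          using V_translate[OF u(2), of "x + c + l" i] M'_closed(3)[OF \<open>k i - l \<in> M'\<close>]
          by (simp add: k_def algebra_simps)
        ultimately show ?thesis using i(1) by blast
      qed
    qed
    then have "P y \<in> S" if "P y \<in> M" for y using that by (auto simp: K_def)
    then show "M \<subseteq> S" using P_surj by (metis subsetI)
  qed
  moreover have "?a \<in> topspace (Euclidean_space (D - 1))"
    by (simp add: topspace_Euclidean_space)
  moreover have "\<phi> (torus_proj M' z) = (\<lambda>i. ?A z i + ?a i)" if "z \<in> C" for z
  proof
    fix j
    show "\<phi> (torus_proj M' z) j = ?A z j + ?a j"
      using that th[of "j + 2" z] th[of 1 z] D_pos
      by (auto simp: theta_map_eq tropical_point_def C inner_diff_left)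
  qed
  ultimately show "\<exists>A. \<exists>a\<in>topspace (Euclidean_space (D - 1)). unimodular_linear M (D - 1) A \<and>
      (\<forall>z\<in>C. \<phi> (torus_proj M' z) = (\<lambda>i. A z i + a i))"
    by (intro exI[of _ ?A] bexI[of _ ?a] conjI ballI)
qed

end

section \<open>From the descent datum and its type to the geometric data\<close>

lemma polarized_exists:
  assumes "full_lattice M" "full_lattice M'" "positive_line_bundle M M' lam \<gamma>"
  obtains P c where "polarized P M M'" "\<And>u. u \<in> M' \<Longrightarrow> lam u = P u"
    "\<And>u. u \<in> M' \<Longrightarrow> \<gamma> u = (P u \<bullet> u) / 2 + P c \<bullet> u"
proof -
  have hom: "lam ` M' \<subseteq> M" and \<gamma>: "\<And>u v. u \<in> M' \<Longrightarrow> v \<in> M' \<Longrightarrow> \<gamma> (u + v) - \<gamma> u - \<gamma> v = lam v \<bullet> u"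
    using assms(3) by (auto simp: positive_line_bundle_def tropical_descent_datum_def lattice_hom_def)
  obtain B :: "'a \<Rightarrow> 'a \<Rightarrow> real" where B: "bilinear B" "\<And>x y. B x y = B y x"
      "\<And>u v. u \<in> M' \<Longrightarrow> v \<in> M' \<Longrightarrow> B u v = lam u \<bullet> v" "\<And>x. x \<noteq> 0 \<Longrightarrow> B x x > 0"
    using assms(3) by (auto simp: positive_line_bundle_def polarization_def)
  have lin: "linear (B x)" "linear (\<lambda>x. B x y)" for x y
    using B(1) by (auto simp: bilinear_def)
  \<comment> \<open>The vector that represents the functional \<open>B x\<close> through the inner
    product.\<close>
  define P where "P x = adjoint (B x) 1" for x
  have P_B: "P x \<bullet> y = B x y" for x y
    using adjoint_works[OF lin(1), of y x 1] by (simp add: P_def inner_commute)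
  have P_lin: "linear P"
  proof (rule linearI)
    fix x y :: 'a and r :: real
    show "P (x + y) = P x + P y"
      by (rule vector_eq_rdot[THEN iffD1]) (simp add: P_B inner_add_left linear_add[OF lin(2)])
    show "P (r *\<^sub>R x) = r *\<^sub>R P x"
      by (rule vector_eq_rdot[THEN iffD1]) (simp add: P_B linear_scale[OF lin(2)])
  qed
  have lam: "lam u = P u" if "u \<in> M'" for u
  proof -
    have eq: "(\<lambda>v. lam u \<bullet> v) = (\<lambda>v. P u \<bullet> v)"
      by (rule full_lattice_eq_on[OF assms(2)])
        (auto simp: P_B B(3) that intro: bounded_linear.linear[OF bounded_linear_inner_right] lin)
    have "lam u \<bullet> v = P u \<bullet> v" for v by (rule fun_cong[OF eq])
    then show ?thesis by (rule vector_eq_rdot[THEN iffD1, OF allI])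
  qed
  have pol: "polarized P M M'"
    using P_lin hom lam assms(1,2) B(2,4) by (intro polarized.intro) (auto simp: P_B)
  then interpret polarized P M M' 0 .
  \<comment> \<open>By the cocycle condition, subtracting half of \<open>q\<close> leaves an
    additive function; surjectivity of \<open>P\<close> then writes its linear form as
    \<open>P c\<close>.\<close>
  have add: "\<gamma> (u + v) - q (u + v) / 2 = (\<gamma> u - q u / 2) + (\<gamma> v - q v / 2)" if "u \<in> M'" "v \<in> M'" for u v
    using \<gamma>[OF that] that by (simp add: q_add lam Q_def P_sym[of v u] field_simps)
  obtain a where a: "\<And>u. u \<in> M' \<Longrightarrow> \<gamma> u - q u / 2 = a \<bullet> u"
    by (rule full_lattice_additive[OF assms(2), where h = "\<lambda>u. \<gamma> u - q u / 2", OF add])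
      (assumption+, rule that)
  obtain c where c: "P c = a" using P_surj by blast
  have "\<gamma> u = (P u \<bullet> u) / 2 + P c \<bullet> u" if "u \<in> M'" for u
    using a[OF that] by (simp add: c q_def Q_def)
  with pol lam show ?thesis by (rule that)
qed

text \<open>Every \<open>d i\<close> is a multiple of \<open>d 1\<close>, so \<open>P\<close> maps
  the basis of \<open>M'\<close>, and with it all of \<open>M'\<close>, into \<open>d 1\<close>
  times \<open>M\<close>.\<close>

lemma polarization_type_divides:
  fixes M M' :: "'a::euclidean_space set"
  assumes "polarization_type M M' lam d" "full_lattice M"
    and P: "linear P" "inj P" "\<And>u. u \<in> M' \<Longrightarrow> lam u = P u" and u: "u \<in> M'"
  shows "\<exists>w\<in>P -` M. u = of_nat (d 1) *\<^sub>R w"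
proof -
  obtain e f where e: "is_zbasis M' e" and f: "is_zbasis M f"
    and ef: "\<And>i. i \<in> {1..DIM('a)} \<Longrightarrow> lam (e i) = of_nat (d i) *\<^sub>R f i"
    using assms(1) by (auto simp: polarization_type_def)
  have dvd: "d 1 dvd d i" if "i \<in> {1..DIM('a)}" for i
  proof -
    have "1 \<le> i" "i \<le> DIM('a)" using that by auto
    then show ?thesis
    proof (induction i rule: dec_induct)
      case (step n)
      then have "d n dvd d (Suc n)" using assms(1) by (auto simp: polarization_type_def)
      then show ?case using step by (auto intro: dvd_trans)
    qed simp
  qed
  have d1: "d 1 > 0" using assms(1) DIM_positive by (auto simp: polarization_type_def Suc_le_eq)
  let ?S = "(\<lambda>m. of_nat (d 1) *\<^sub>R m) ` M"
  note sgM = full_lattice_subgroup[OF assms(2)]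
  have S: "subgroup_set (P -` ?S)"
    unfolding subgroup_set_def
  proof (intro conjI ballI)
    show "0 \<in> P -` ?S" using subgroup_setD(1)[OF sgM] by (force simp: linear_0[OF P(1)])
    fix x y assume "x \<in> P -` ?S" "y \<in> P -` ?S"
    then obtain m m' where "m \<in> M" "m' \<in> M" "P x = of_nat (d 1) *\<^sub>R m" "P y = of_nat (d 1) *\<^sub>R m'"
      by blast
    then have "P (x - y) = of_nat (d 1) *\<^sub>R (m - m')" "m - m' \<in> M"
      using subgroup_setD(2)[OF sgM] by (auto simp: linear_diff[OF P(1)] scaleR_diff_right)
    then show "x - y \<in> P -` ?S" by blast
  qed
  have "M' \<subseteq> P -` ?S"
  proof (rule zbasis_subset_subgroup[OF e S])
    fix i assume i: "i \<in> {1..DIM('a)}"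
    obtain j where j: "d i = d 1 * j" using dvd[OF i] by blast
    have fi: "f i \<in> M" using i by (auto intro: zbasis_coordinates[OF f])
    have ei: "e i \<in> M'" using i by (auto intro: zbasis_coordinates[OF e])
    have "P (e i) = of_nat (d 1) *\<^sub>R (of_int (int j) *\<^sub>R f i)"
      using ef[OF i] P(3)[OF ei] by (simp add: j)
    then show "e i \<in> P -` ?S"
      using subgroup_set_scale_int[OF sgM fi, of "int j"] by blast
  qed
  then obtain m where m: "m \<in> M" "P u = of_nat (d 1) *\<^sub>R m" using u by blast
  define w where "w = (1 / of_nat (d 1)) *\<^sub>R u"
  have "P w = m" using m d1 by (simp add: w_def linear_scale[OF P(1)])
  then show ?thesis using m(1) d1 by (intro bexI[of _ w]) (auto simp: w_def)
qed

theorem theorem4p3: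
  fixes M M' :: "'a::euclidean_space set"
    and lam :: "'a \<Rightarrow> 'a" and \<gamma> :: "'a \<Rightarrow> real"
    and d :: "nat \<Rightarrow> nat" and D :: nat and b :: "nat \<Rightarrow> 'a"
    and \<phi> :: "'a set \<Rightarrow> nat \<Rightarrow> real"
  assumes "tropical_abelian_variety M M'"
    and "positive_line_bundle M M' lam \<gamma>"
    and "polarization_type M M' lam d"
    and "D = (\<Prod>i=1..DIM('a). d i)"
    and "coset_representatives M M' lam D b"
    and "\<phi> = theta_map M' lam \<gamma> D b"
  shows "(d 1 \<ge> 3 \<longrightarrow> embedding_map (torus M') (Euclidean_space (D - 1)) \<phi>) \<and>
         (d 1 \<ge> 2 * fact (DIM('a) - 1) \<longrightarrow> unimodular M M' (D - 1) \<phi>) \<and>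
         (d 1 \<ge> max 3 (2 * fact (DIM('a) - 1)) \<longrightarrow> faithful_embedding M M' (D - 1) \<phi>)"
proof -
  have M: "full_lattice M" "full_lattice M'"
    using assms(1) by (auto simp: tropical_abelian_variety_def)
  obtain P c where pol: "polarized P M M'" and lam: "\<And>u. u \<in> M' \<Longrightarrow> lam u = P u"
    and \<gamma>: "\<And>u. u \<in> M' \<Longrightarrow> \<gamma> u = (P u \<bullet> u) / 2 + P c \<bullet> u"
    by (rule polarized_exists[OF M assms(2)]) (rule that)
  interpret polarized P M M' c by (rule pol)
  interpret polarized_theta P M M' c lam \<gamma> b D "d 1"
  proof
    show "\<gamma> u = q u / 2 + Q c u" if "u \<in> M'" for u
      using \<gamma>[OF that] by (simp add: q_def Q_def)
    show "\<exists>w\<in>K. u = of_nat (d 1) *\<^sub>R w" if "u \<in> M'" for u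
      unfolding K_def by (rule polarization_type_divides[OF assms(3) M(1) P P_inj lam that])
  qed (use lam assms(5) in auto)
  \<comment> \<open>The factorial is at least 1, so the bound in (2) yields the
    \<open>d 1 \<ge> 2\<close> that \<open>unimodular_theta_map\<close> asks for.\<close>
  have "(1::nat) \<le> fact (DIM('a) - 1)" by (rule fact_ge_1)
  then have "d 1 \<ge> 2" if "d 1 \<ge> 2 * fact (DIM('a) - 1)"
    using that by linarith
  then show ?thesis
    using embedding_map_theta_map unimodular_theta_map unfolding assms(6) faithful_embedding_def
    by auto
qed

end
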